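(* Let $m,n,k$ be non-negative integers with $1\le k\le n$, let $q$ be an integer with $0\le q\le n-k+1$, and suppose $k\ne1$ or $m+q\ne1$. Then the sum over all $(m,n,k)$-Magog trapezoids with exactly $q$ minima of $P^{\#\text{maxima}}$ equals the constant term in $x_1,\dots,x_{m+n-1}$ of $$P^{[m=0]}\prod_{i=1}^{m+n-1}(1+x_i)^nx_i^{-i-k+2}(1-x_i)^{-1}\prod_{i=\max(m,1)}^{m+n-1}(1+x_i)^{m-i-1}(Px_i+1)\prod_{1\le i<j\le m+n-1}\frac{x_j-x_i}{1-x_ix_j}\times R,$$ where $$R=\sum_{i=1}^{k+m+q-2}(1+x_i)^{k+q-n-1}(1-x_i)\prod_{1\le j\le m+n-1,\ j\ne i}\frac{1-x_ix_j}{x_j-x_i}\quad\text{if }q\le n-k,\qquad R=1\quad\text{if }q=n-k+1.$$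
   Context: For non-negative integers $m,n,k$ with $k\le n$, an $(m,n,k)$-Magog trapezoid is an array $(m_{i,j})$ of positive integers indexed by $1\le j\le i\le n$ with $i-j\le k-1$ (the $k$ rightmost SE-diagonals of a triangular array with $n$ rows), such that $m_{i+1,j}\le m_{i,j}\le m_{i+1,j+1}$ whenever these entries exist and $m_{i,j}\le m+j$. A minimum is an entry equal to $1$ in the leftmost SE-diagonal $\{m_{i,j}:i-j=k-1\}$; a maximum is an entry $m_{j,j}$ with $m_{j,j}=m+j$. $P$ is an indeterminate; $[m=0]$ is $1$ if $m=0$ and $0$ otherwise. Negative powers of $(1+x_i)$, $(1-x_i)^{-1}$ and $\frac{1}{1-x_ix_j}$ are expanded as power series in the variables with non-negative exponents. *)

theory Defs
  imports
    "HOL-Library.Poly_Mapping"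
    "HOL-Computational_Algebra.Computational_Algebra"
begin

section \<open>Formal power series in countably many variables\<close>

text \<open>
  A power series is its family of coefficients, indexed by the monomials, i.e. by the
  finitely supported exponent vectors. The variables are indexed by all of \<open>nat\<close>, so
  that series in any number of variables live in one type.
\<close>

typedef 'a mfps = "UNIV :: ((nat \<Rightarrow>\<^sub>0 nat) \<Rightarrow> 'a) set"
  morphisms mfps_nth Abs_mfps
  by simp

lemma Abs_mfps_nth [simp]: "mfps_nth (Abs_mfps f) = f"
  by (simp add: Abs_mfps_inverse)

lemma mfps_eqI: "(\<And>k. mfps_nth f k = mfps_nth g k) \<Longrightarrow> f = g"
  by (metis ext mfps_nth_inject)

lemma mfps_eq_iff: "f = g \<longleftrightarrow> (\<forall>k. mfps_nth f k = mfps_nth g k)"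
  by (auto intro: mfps_eqI)

definition splittings :: "(nat \<Rightarrow>\<^sub>0 nat) \<Rightarrow> ((nat \<Rightarrow>\<^sub>0 nat) \<times> (nat \<Rightarrow>\<^sub>0 nat)) set" where
  "splittings k = {(a, b). a + b = k}"

lemma finite_below_monomial:
  fixes k :: "nat \<Rightarrow>\<^sub>0 nat"
  shows "finite {a. \<forall>x. Poly_Mapping.lookup a x \<le> Poly_Mapping.lookup k x}"
proof (rule finite_imageD[where f = Poly_Mapping.lookup])
  let ?B = "Max (insert 0 (Poly_Mapping.lookup k ` Poly_Mapping.keys k))"
  have "Poly_Mapping.lookup ` {a. \<forall>x. Poly_Mapping.lookup a x \<le> Poly_Mapping.lookup k x} \<subseteq>
      {f. \<forall>x. (x \<in> Poly_Mapping.keys k \<longrightarrow> f x \<in> {..?B}) \<and> (x \<notin> Poly_Mapping.keys k \<longrightarrow> f x = 0)}"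
  proof safe
    fix a x assume a: "\<forall>x. Poly_Mapping.lookup a x \<le> Poly_Mapping.lookup k x"
    {
      assume "x \<in> Poly_Mapping.keys k"
      then have "Poly_Mapping.lookup k x \<le> ?B" by (intro Max_ge) auto
      with a show "Poly_Mapping.lookup a x \<le> ?B" by (meson le_trans)
    next
      assume "x \<notin> Poly_Mapping.keys k"
      with a show "Poly_Mapping.lookup a x = 0" by (metis in_keys_iff le_zero_eq)
    }
  qed
  then show "finite (Poly_Mapping.lookup ` {a. \<forall>x. Poly_Mapping.lookup a x \<le> Poly_Mapping.lookup k x})"
    by (rule finite_subset) (rule finite_set_of_finite_funs; simp)
qed (auto intro: inj_onI poly_mapping_eqI)

lemma finite_splittings [simp]: "finite (splittings k)"
proof (rule finite_subset)
  let ?A = "{a. \<forall>x. Poly_Mapping.lookup a x \<le> Poly_Mapping.lookup k x}"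
  show "splittings k \<subseteq> ?A \<times> ?A"
    by (auto simp: splittings_def lookup_add)
  show "finite (?A \<times> ?A)"
    by (intro finite_cartesian_product finite_below_monomial)
qed

instantiation mfps :: (comm_ring_1) comm_ring_1
begin

definition "0 = Abs_mfps (\<lambda>_. 0)"
definition "1 = Abs_mfps (\<lambda>k. if k = 0 then 1 else 0)"
definition "f + g = Abs_mfps (\<lambda>k. mfps_nth f k + mfps_nth g k)"
definition "f - g = Abs_mfps (\<lambda>k. mfps_nth f k - mfps_nth g k)"
definition "- f = Abs_mfps (\<lambda>k. - mfps_nth f k)"
definition "f * g = Abs_mfps (\<lambda>k. \<Sum>(a, b)\<in>splittings k. mfps_nth f a * mfps_nth g b)"

lemma mfps_zero_nth [simp]: "mfps_nth 0 k = 0"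
  and mfps_one_nth: "mfps_nth 1 k = (if k = 0 then 1 else 0)"
  and mfps_add_nth [simp]: "mfps_nth (f + g) k = mfps_nth f k + mfps_nth g k"
  and mfps_diff_nth [simp]: "mfps_nth (f - g) k = mfps_nth f k - mfps_nth g k"
  and mfps_uminus_nth [simp]: "mfps_nth (- f) k = - mfps_nth f k"
  and mfps_mult_nth:
    "mfps_nth (f * g) k = (\<Sum>(a, b)\<in>splittings k. mfps_nth f a * mfps_nth g b)"
  by (simp_all add: zero_mfps_def one_mfps_def plus_mfps_def minus_mfps_def
      uminus_mfps_def times_mfps_def)

instance
proof
  fix f g h :: "'a mfps"
  show "f * g * h = f * (g * h)"
  proof (rule mfps_eqI)
    fix k
    have "mfps_nth (f * g * h) k =
        (\<Sum>p\<in>splittings k. \<Sum>r\<in>splittings (fst p).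
          mfps_nth f (fst r) * mfps_nth g (snd r) * mfps_nth h (snd p))"
      by (simp add: mfps_mult_nth case_prod_unfold sum_distrib_right)
    also have "\<dots> = (\<Sum>(p, r)\<in>(SIGMA p:splittings k. splittings (fst p)).
          mfps_nth f (fst r) * mfps_nth g (snd r) * mfps_nth h (snd p))"
      by (rule sum.Sigma) auto
    also have "\<dots> = (\<Sum>(p, r)\<in>(SIGMA p:splittings k. splittings (snd p)).
          mfps_nth f (fst p) * (mfps_nth g (fst r) * mfps_nth h (snd r)))"
      by (rule sum.reindex_bij_witness
          [where i = "\<lambda>(p, r). ((fst p + fst r, snd r), (fst p, fst r))"
             and j = "\<lambda>(p, r). ((fst r, snd r + snd p), (snd r, snd p))"])
        (auto simp: splittings_def algebra_simps)
    also have "\<dots> = (\<Sum>p\<in>splittings k. \<Sum>r\<in>splittings (snd p).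
          mfps_nth f (fst p) * (mfps_nth g (fst r) * mfps_nth h (snd r)))"
      by (rule sum.Sigma [symmetric]) auto
    also have "\<dots> = mfps_nth (f * (g * h)) k"
      by (simp add: mfps_mult_nth case_prod_unfold sum_distrib_left)
    finally show "mfps_nth (f * g * h) k = mfps_nth (f * (g * h)) k" .
  qed
  show "f * g = g * f"
  proof (rule mfps_eqI)
    fix k
    show "mfps_nth (f * g) k = mfps_nth (g * f) k"
      unfolding mfps_mult_nth
      by (rule sum.reindex_bij_witness[where i = prod.swap and j = prod.swap])
        (auto simp: splittings_def algebra_simps)
  qed
  show "1 * f = f"
  proof (rule mfps_eqI)
    fix k
    have "mfps_nth (1 * f) k =
        (\<Sum>p\<in>splittings k. if p = (0, k) then mfps_nth f k else 0)"
      unfolding mfps_mult_nth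
      by (rule sum.cong) (auto simp: mfps_one_nth splittings_def split: if_splits)
    also have "\<dots> = mfps_nth f k"
      by (subst sum.delta[OF finite_splittings]) (auto simp: splittings_def)
    finally show "mfps_nth (1 * f) k = mfps_nth f k" .
  qed
  show "(f + g) * h = f * h + g * h"
    by (rule mfps_eqI)
      (simp add: mfps_mult_nth case_prod_unfold sum.distrib distrib_right)
  show "(0 :: 'a mfps) \<noteq> 1"
    by (metis mfps_one_nth mfps_zero_nth zero_neq_one)
qed (rule mfps_eqI; simp add: algebra_simps)+

end

text \<open>
  The lexicographic order on finitely supported exponent vectors is not well-founded, but
  a non-empty set of them always has a minimum as long as only the first \<open>N\<close> exponents
  matter. This gives the absence of zero divisors.
\<close>

lemma lex_min_prefix:
  fixes S :: "(nat \<Rightarrow>\<^sub>0 nat) set"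
  assumes "S \<noteq> {}"
  shows "\<exists>s\<in>S. \<forall>t\<in>S. (\<forall>j<N. Poly_Mapping.lookup t j = Poly_Mapping.lookup s j) \<or>
      (\<exists>i<N. Poly_Mapping.lookup s i < Poly_Mapping.lookup t i \<and> (\<forall>j<i. Poly_Mapping.lookup s j = Poly_Mapping.lookup t j))"
proof (induction N)
  case 0
  then show ?case using assms by auto
next
  case (Suc N)
  then obtain s where s: "s \<in> S"
    and min: "\<And>t. t \<in> S \<Longrightarrow> (\<forall>j<N. Poly_Mapping.lookup t j = Poly_Mapping.lookup s j) \<or>
      (\<exists>i<N. Poly_Mapping.lookup s i < Poly_Mapping.lookup t i \<and> (\<forall>j<i. Poly_Mapping.lookup s j = Poly_Mapping.lookup t j))"
    by blast
  let ?Q = "\<lambda>t. t \<in> S \<and> (\<forall>j<N. Poly_Mapping.lookup t j = Poly_Mapping.lookup s j)"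
  obtain u where u: "?Q u" and umin: "\<And>t. ?Q t \<Longrightarrow> Poly_Mapping.lookup u N \<le> Poly_Mapping.lookup t N"
    using ex_has_least_nat[of ?Q s "\<lambda>t. Poly_Mapping.lookup t N"] s by blast
  show ?case
  proof (intro bexI[of _ u] ballI)
    fix t assume t: "t \<in> S"
    show "(\<forall>j<Suc N. Poly_Mapping.lookup t j = Poly_Mapping.lookup u j) \<or>
      (\<exists>i<Suc N. Poly_Mapping.lookup u i < Poly_Mapping.lookup t i \<and> (\<forall>j<i. Poly_Mapping.lookup u j = Poly_Mapping.lookup t j))"
    proof (cases "\<forall>j<N. Poly_Mapping.lookup t j = Poly_Mapping.lookup s j")
      case True
      with t umin have "Poly_Mapping.lookup u N \<le> Poly_Mapping.lookup t N" by blast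
      then consider "Poly_Mapping.lookup u N = Poly_Mapping.lookup t N" | "Poly_Mapping.lookup u N < Poly_Mapping.lookup t N" by linarith
      then show ?thesis
        using True u by cases (auto simp: less_Suc_eq)
    next
      case False
      with min[OF t] obtain i where
        "i < N" "Poly_Mapping.lookup s i < Poly_Mapping.lookup t i" "\<forall>j<i. Poly_Mapping.lookup s j = Poly_Mapping.lookup t j" by blast
      with u show ?thesis by (intro disjI2 exI[of _ i]) auto
    qed
  qed (use u in simp)
qed

lemma min_monomial:
  fixes f :: "(nat \<Rightarrow>\<^sub>0 nat) \<Rightarrow> 'a::zero"
  assumes "f a0 \<noteq> 0" "Poly_Mapping.keys a0 \<subseteq> {..<N}"
  obtains a where "f a \<noteq> 0" "Poly_Mapping.keys a \<subseteq> {..<N}"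
    "\<And>b. f b \<noteq> 0 \<Longrightarrow> Poly_Mapping.keys b \<subseteq> {..<N} \<Longrightarrow> a \<le> b"
proof -
  let ?S = "{a. f a \<noteq> 0 \<and> Poly_Mapping.keys a \<subseteq> {..<N}}"
  have "?S \<noteq> {}" using assms by blast
  from lex_min_prefix[OF this, of N] obtain s where s: "s \<in> ?S"
    and min: "\<And>t. t \<in> ?S \<Longrightarrow> (\<forall>j<N. Poly_Mapping.lookup t j = Poly_Mapping.lookup s j) \<or>
      (\<exists>i<N. Poly_Mapping.lookup s i < Poly_Mapping.lookup t i \<and> (\<forall>j<i. Poly_Mapping.lookup s j = Poly_Mapping.lookup t j))"
    by blast
  show ?thesis
  proof (rule that[of s])
    fix b assume "f b \<noteq> 0" "Poly_Mapping.keys b \<subseteq> {..<N}"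
    then have b: "b \<in> ?S" by simp
    have zero: "Poly_Mapping.lookup c j = 0" if "c \<in> ?S" "\<not> j < N" for c j
      using that by (metis (mono_tags, lifting) in_keys_iff lessThan_iff mem_Collect_eq subsetD)
    from min[OF b] show "s \<le> b"
    proof
      assume "\<forall>j<N. Poly_Mapping.lookup b j = Poly_Mapping.lookup s j"
      then have "b = s" by (intro poly_mapping_eqI) (metis b s zero)
      then show ?thesis by simp
    next
      assume "\<exists>i<N. Poly_Mapping.lookup s i < Poly_Mapping.lookup b i \<and> (\<forall>j<i. Poly_Mapping.lookup s j = Poly_Mapping.lookup b j)"
      then have "s < b"
        by (auto simp: less_poly_mapping.rep_eq less_fun_def)
      then show ?thesis by simp
    qed
  qed (use s in auto)
qed

instance mfps :: (idom) idom
proof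
  fix f g :: "'a mfps"
  assume "f \<noteq> 0" "g \<noteq> 0"
  then obtain a0 b0 where 0: "mfps_nth f a0 \<noteq> 0" "mfps_nth g b0 \<noteq> 0"
    by (auto simp: mfps_eq_iff)
  obtain N where "Poly_Mapping.keys a0 \<union> Poly_Mapping.keys b0 \<subseteq> {..<N}"
    using finite_nat_bounded[of "Poly_Mapping.keys a0 \<union> Poly_Mapping.keys b0"] by auto
  then have N: "Poly_Mapping.keys a0 \<subseteq> {..<N}" "Poly_Mapping.keys b0 \<subseteq> {..<N}" by auto
  obtain a where a: "mfps_nth f a \<noteq> 0" "Poly_Mapping.keys a \<subseteq> {..<N}"
    and amin: "\<And>b. mfps_nth f b \<noteq> 0 \<Longrightarrow> Poly_Mapping.keys b \<subseteq> {..<N} \<Longrightarrow> a \<le> b"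
    by (rule min_monomial[where f = "mfps_nth f", OF 0(1) N(1)]) blast
  obtain b where b: "mfps_nth g b \<noteq> 0" "Poly_Mapping.keys b \<subseteq> {..<N}"
    and bmin: "\<And>c. mfps_nth g c \<noteq> 0 \<Longrightarrow> Poly_Mapping.keys c \<subseteq> {..<N} \<Longrightarrow> b \<le> c"
    by (rule min_monomial[where f = "mfps_nth g", OF 0(2) N(2)]) blast
  have "mfps_nth f c * mfps_nth g d = 0"
    if cd: "(c, d) \<in> splittings (a + b)" "(c, d) \<noteq> (a, b)" for c d
  proof (rule ccontr)
    assume "mfps_nth f c * mfps_nth g d \<noteq> 0"
    then have nz: "mfps_nth f c \<noteq> 0" "mfps_nth g d \<noteq> 0" by auto
    have eq: "c + d = a + b" using cd by (simp add: splittings_def)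
    have "Poly_Mapping.lookup c j = 0 \<and> Poly_Mapping.lookup d j = 0" if "\<not> j < N" for j
    proof -
      have "Poly_Mapping.lookup a j = 0" "Poly_Mapping.lookup b j = 0"
        using that a(2) b(2) by (metis in_keys_iff lessThan_iff subsetD)+
      then have "Poly_Mapping.lookup (c + d) j = 0" unfolding eq by (simp add: lookup_add)
      then show ?thesis by (simp add: lookup_add)
    qed
    then have "Poly_Mapping.keys c \<subseteq> {..<N}" "Poly_Mapping.keys d \<subseteq> {..<N}"
      by (auto simp: in_keys_iff)
    with nz have "a \<le> c" "b \<le> d" using amin bmin by blast+
    with eq have "c = a \<and> d = b"
      by (metis add_le_less_mono add_less_le_mono less_irrefl order.not_eq_order_implies_strict)
    with cd show False by simp
  qed
  then have "mfps_nth (f * g) (a + b) =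
      (\<Sum>p\<in>splittings (a + b). if p = (a, b) then mfps_nth f a * mfps_nth g b else 0)"
    unfolding mfps_mult_nth by (intro sum.cong refl) (fastforce split: prod.splits)
  also have "\<dots> = mfps_nth f a * mfps_nth g b"
    by (subst sum.delta[OF finite_splittings]) (auto simp: splittings_def)
  finally have "mfps_nth (f * g) (a + b) \<noteq> 0" using a b by simp
  then show "f * g \<noteq> 0" by (metis mfps_zero_nth)
qed

definition mfps_monom :: "(nat \<Rightarrow>\<^sub>0 nat) \<Rightarrow> 'a::comm_ring_1 mfps" where
  "mfps_monom a = Abs_mfps (\<lambda>k. if k = a then 1 else 0)"

definition mfps_const :: "'a::comm_ring_1 \<Rightarrow> 'a mfps" where
  "mfps_const c = Abs_mfps (\<lambda>k. if k = 0 then c else 0)"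

lemma mfps_monom_nth: "mfps_nth (mfps_monom a) k = (if k = a then 1 else 0)"
  by (simp add: mfps_monom_def)

lemma mfps_const_nth: "mfps_nth (mfps_const c) k = (if k = 0 then c else 0)"
  by (simp add: mfps_const_def)

lemma mfps_monom_mult:
  "mfps_monom a * mfps_monom b = (mfps_monom (a + b) :: 'a::comm_ring_1 mfps)"
proof (rule mfps_eqI)
  fix k :: "nat \<Rightarrow>\<^sub>0 nat"
  have "mfps_nth (mfps_monom a * mfps_monom b :: 'a mfps) k =
      (\<Sum>p\<in>splittings k. if p = (a, b) then 1 else (0::'a))"
    unfolding mfps_mult_nth by (rule sum.cong) (auto simp: mfps_monom_nth split: if_splits)
  also have "\<dots> = mfps_nth (mfps_monom (a + b) :: 'a mfps) k"
    by (subst sum.delta[OF finite_splittings]) (auto simp: splittings_def mfps_monom_nth)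
  finally show "mfps_nth (mfps_monom a * mfps_monom b) k = mfps_nth (mfps_monom (a + b) :: 'a mfps) k" .
qed

lemma mfps_mult_monom_nth: "mfps_nth (f * mfps_monom b) (a + b) = mfps_nth f a"
proof -
  have "mfps_nth (f * mfps_monom b) (a + b) =
      (\<Sum>p\<in>splittings (a + b). if p = (a, b) then mfps_nth f a else 0)"
    unfolding mfps_mult_nth
    by (rule sum.cong) (auto simp: mfps_monom_nth splittings_def split: if_splits)
  also have "\<dots> = mfps_nth f a"
    by (subst sum.delta[OF finite_splittings]) (auto simp: splittings_def)
  finally show ?thesis .
qed

section \<open>Constant terms\<close>

text \<open>
  Products and quotients of Laurent polynomials and power series are formed in the
  fraction field of the power series ring. A power series with invertible constant
  coefficient has a unique inverse there, namely its power series inverse; so, for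
  instance, \<open>1 / (1 - x * y)\<close> is the geometric series in \<open>x * y\<close>. Quotients such as
  \<open>1 / (y - x)\<close>, which have no preferred expansion, exist in this field as well.
\<close>

definition mfps_fract :: "'a::idom mfps \<Rightarrow> 'a mfps fract" where
  "mfps_fract f = Fraction_Field.Fract f 1"

lemma mfps_fract_eq_iff: "mfps_fract f = mfps_fract g \<longleftrightarrow> f = g"
  by (simp add: mfps_fract_def eq_fract)

lemma mfps_fract_mult: "mfps_fract (f * g) = mfps_fract f * mfps_fract g"
  by (simp add: mfps_fract_def)

text \<open>
  The fraction \<open>F\<close> is a Laurent series, i.e. a power series divided by a monomial, and its
  constant term is \<open>c\<close>. If \<open>F\<close> involves only some of the variables, this is
  the constant term with respect to these.
\<close>

definition has_constant_term :: "'a::idom mfps fract \<Rightarrow> 'a \<Rightarrow> bool" where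
  "has_constant_term F c \<longleftrightarrow>
    (\<exists>a g. F = mfps_fract g / mfps_fract (mfps_monom a) \<and> mfps_nth g a = c)"

lemma has_constant_term_unique:
  assumes "has_constant_term F c" "has_constant_term F d"
  shows "c = d"
proof -
  obtain a g where g: "F = mfps_fract g / mfps_fract (mfps_monom a)" "mfps_nth g a = c"
    using assms(1) unfolding has_constant_term_def by blast
  obtain b h where h: "F = mfps_fract h / mfps_fract (mfps_monom b)" "mfps_nth h b = d"
    using assms(2) unfolding has_constant_term_def by blast
  have nz: "mfps_fract (mfps_monom e) \<noteq> (0 :: 'a mfps fract)" for e
  proof -
    have "mfps_monom e \<noteq> (0 :: 'a mfps)"
      by (metis mfps_monom_nth mfps_zero_nth zero_neq_one)
    then show ?thesis
      using mfps_fract_eq_iff[of "mfps_monom e" "0 :: 'a mfps"]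
      by (simp add: mfps_fract_def Zero_fract_def)
  qed
  have "mfps_fract (g * mfps_monom b) = mfps_fract (h * mfps_monom a)"
    using g(1) h(1) nz[of a] nz[of b] by (simp add: mfps_fract_mult frac_eq_eq)
  then have eq: "g * mfps_monom b = h * mfps_monom a"
    by (simp only: mfps_fract_eq_iff)
  have "c = mfps_nth (g * mfps_monom b) (a + b)"
    using g(2) by (simp add: mfps_mult_monom_nth)
  also have "\<dots> = mfps_nth (h * mfps_monom a) (b + a)"
    unfolding eq by (simp only: add.commute)
  also have "\<dots> = d"
    using h(2) by (simp only: mfps_mult_monom_nth)
  finally show ?thesis .
qed

text \<open>
  The coefficient ring is the polynomial ring over the integers in the indeterminate \<open>P\<close>.
\<close>

definition P_var :: "int poly mfps fract" where
  "P_var = mfps_fract (mfps_const [:0, 1:])"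

definition x_var :: "nat \<Rightarrow> int poly mfps fract" where
  "x_var i = mfps_fract (mfps_monom (Poly_Mapping.single i 1))"

section \<open>Magog trapezoids\<close>

text \<open>The condition \<open>i - j \<le> k - 1\<close> is written without subtraction.\<close>

definition magog_positions :: "nat \<Rightarrow> nat \<Rightarrow> (nat \<times> nat) set" where
  "magog_positions n k = {(i, j). 1 \<le> j \<and> j \<le> i \<and> i \<le> n \<and> i < j + k}"

text \<open>
  An array is a function on all pairs with value \<open>0\<close> outside the trapezoid, where
  entries are positive; so different functions are different arrays.
\<close>

definition magog_trapezoids :: "nat \<Rightarrow> nat \<Rightarrow> nat \<Rightarrow> (nat \<Rightarrow> nat \<Rightarrow> nat) set" where
  "magog_trapezoids m n k = {M.
     (\<forall>i j. (i, j) \<notin> magog_positions n k \<longrightarrow> M i j = 0) \<and>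
     (\<forall>(i, j)\<in>magog_positions n k. 1 \<le> M i j \<and> M i j \<le> m + j) \<and>
     (\<forall>i j. (i, j) \<in> magog_positions n k \<and> (i + 1, j) \<in> magog_positions n k \<longrightarrow>
        M (i + 1) j \<le> M i j) \<and>
     (\<forall>i j. (i, j) \<in> magog_positions n k \<and> (i + 1, j + 1) \<in> magog_positions n k \<longrightarrow>
        M i j \<le> M (i + 1) (j + 1))}"

definition magog_minima :: "nat \<Rightarrow> nat \<Rightarrow> (nat \<Rightarrow> nat \<Rightarrow> nat) \<Rightarrow> (nat \<times> nat) set" where
  "magog_minima n k M = {(i, j)\<in>magog_positions n k. i + 1 = j + k \<and> M i j = 1}"

definition magog_maxima ::
    "nat \<Rightarrow> nat \<Rightarrow> nat \<Rightarrow> (nat \<Rightarrow> nat \<Rightarrow> nat) \<Rightarrow> (nat \<times> nat) set" where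
  "magog_maxima m n k M = {(i, j)\<in>magog_positions n k. i = j \<and> M i j = m + j}"

lemma finite_magog_positions [simp]: "finite (magog_positions n k)"
  by (rule finite_subset[of _ "{..n} \<times> {..n}"]) (auto simp: magog_positions_def)

lemma finite_magog_trapezoids [simp]: "finite (magog_trapezoids m n k)"
proof (rule finite_imageD[where f = "\<lambda>M (i, j). M i j"])
  have "(\<lambda>M (i, j). M i j) ` magog_trapezoids m n k \<subseteq>
      {f. \<forall>p. (p \<in> magog_positions n k \<longrightarrow> f p \<in> {..m + n}) \<and>
              (p \<notin> magog_positions n k \<longrightarrow> f p = 0)}"
    by (fastforce simp: magog_trapezoids_def magog_positions_def)
  then show "finite ((\<lambda>M (i, j). M i j) ` magog_trapezoids m n k)"
    by (rule finite_subset) (rule finite_set_of_finite_funs; simp)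
qed (auto simp: inj_on_def fun_eq_iff)

end

theory Submission
  imports Defs "HOL-Combinatorics.Transposition"
begin

text \<open>
  Reading row \<open>i\<close> of the triangle as a partition and conjugating, a Magog trapezoid becomes a
  semistandard tableau with column heights \<open>h i c\<close>, in which column \<open>c\<close> contains no entry
  \<open>\<le> c - m\<close>; a maximum is an entry of column \<open>c\<close> equal to \<open>c - m + 1\<close>, and the number of minima
  tells when the first column reaches height \<open>k\<close>. Up to the factors coming from the allowed
  column entries, the constant term is a coefficient of
  \<open>\<Prod>i 1 / (1 - x\<^sub>i) * \<Prod>i<j (x\<^sub>j - x\<^sub>i) / (1 - x\<^sub>i x\<^sub>j)\<close>, whose coefficient at \<open>x\<^sup>a\<close> is
  \<open>\<Prod>i<j sgn (a\<^sub>j - a\<^sub>i)\<close>. Each factor \<open>1 + x\<^sub>i\<close> lets column \<open>i\<close> grow by one box or not. By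
  antisymmetry, the growths that violate the order of the column heights cancel, so that the
  coefficient counts tableaux one entry at a time. The terms of \<open>R\<close> stop one column at height
  \<open>k\<close>, and only the term of the first column survives.
\<close>

section \<open>Power series in countably many variables\<close>

text \<open>The sign formula is Littlewood's identity: the product of the 1 / (1 - x_i) and 1 / (1 -
  x_i x_j) is the sum of all Schur polynomials, so times the Vandermonde product it is a sum of
  alternants. It is proved here by a recursion that deletes one variable; for fractions this
  recursion is a partial fraction identity. Deletion also explains R: its summand for i turns the
  alternant product, up to sign, into that of the variables other than x_i. Height h of column c is
  encoded by the exponent c + k - 2 - h. Ordered heights give strictly increasing exponents, a
  broken order gives two equal ones, and k boxes in column 1 make the exponent of x_1 negative. The
  obstacle is that step u treats columns differently: those from m + u on are closed, and m + u - 1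
  carries P. Antisymmetry thus holds only between neighbouring columns that are open, which is just
  enough, since breaking the order makes the right column of the two grow. Column 1 reaches height k
  at step k + q. With w = k + q - 1 this gives the range i < m + w and the power -(n - w) of 1 + x_i
  in R. For k = 1 and m + q = 1 that range is empty, while column 1 may still grow at step k +
  q.\<close>

lemma mfps_const_mult_nth:
  "mfps_nth (mfps_const w * f) k = w * mfps_nth f k"
proof -
  have "mfps_nth (mfps_const w * f) k =
      (\<Sum>p\<in>splittings k. if p = (0, k) then w * mfps_nth f k else 0)"
    unfolding mfps_mult_nth
    by (rule sum.cong) (auto simp: mfps_const_nth splittings_def split: if_splits)
  also have "\<dots> = w * mfps_nth f k"
    by (subst sum.delta[OF finite_splittings]) (auto simp: splittings_def)
  finally show ?thesis .
qed

lemma mfps_monom_mult_nth: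
  "mfps_nth (mfps_monom a * f) b =
    (if \<forall>i. Poly_Mapping.lookup a i \<le> Poly_Mapping.lookup b i then mfps_nth f (b - a) else 0)"
proof (cases "\<forall>i. Poly_Mapping.lookup a i \<le> Poly_Mapping.lookup b i")
  case True
  then have "b = (b - a) + a"
    by (intro poly_mapping_eqI) (simp add: lookup_add lookup_minus)
  then show ?thesis
    using True mfps_mult_monom_nth[of f a "b - a"] by (simp add: mult.commute)
next
  case False
  have "mfps_nth (mfps_monom a * f) b = 0"
    unfolding mfps_mult_nth
  proof (intro sum.neutral ballI)
    fix p assume "p \<in> splittings b"
    then have "fst p + snd p = b" by (auto simp: splittings_def)
    then have "fst p \<noteq> a" using False by (auto simp: lookup_add)
    then show "(case p of (c, d) \<Rightarrow> mfps_nth (mfps_monom a) c * mfps_nth f d) = 0"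
      by (simp add: case_prod_unfold mfps_monom_nth)
  qed
  then show ?thesis unfolding if_not_P[OF False] .
qed

definition mfps_X :: "nat \<Rightarrow> 'a::comm_ring_1 mfps" where
  "mfps_X i = mfps_monom (Poly_Mapping.single i 1)"

lemma mfps_X_mult_nth:
  "mfps_nth (mfps_X i * f) b =
    (if Poly_Mapping.lookup b i = 0 then 0 else mfps_nth f (b - Poly_Mapping.single i 1))"
proof -
  have "(\<forall>j. Poly_Mapping.lookup (Poly_Mapping.single i (1::nat)) j \<le> Poly_Mapping.lookup b j) \<longleftrightarrow>
      Poly_Mapping.lookup b i \<noteq> 0"
    by (auto simp: lookup_single when_def Suc_le_eq)
  then show ?thesis unfolding mfps_X_def mfps_monom_mult_nth by auto
qed

lemma mfps_monom_0: "mfps_monom 0 = 1"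
  by (rule mfps_eqI) (simp add: mfps_monom_nth mfps_one_nth)

lemma mfps_const_1: "mfps_const 1 = 1"
  by (rule mfps_eqI) (simp add: mfps_const_nth mfps_one_nth)

lemma mfps_nth_mult_0: "mfps_nth (f * g) 0 = mfps_nth f 0 * mfps_nth g 0"
proof -
  have "splittings 0 = {(0, 0)}"
    unfolding splittings_def
    by (auto simp: poly_mapping_eq_iff fun_eq_iff lookup_add)
  then show ?thesis by (simp add: mfps_mult_nth)
qed

lemma mfps_X_nth_0 [simp]: "mfps_nth (mfps_X i) 0 = 0"
proof -
  have "(0 :: nat \<Rightarrow>\<^sub>0 nat) \<noteq> Poly_Mapping.single i 1"
    by (metis lookup_single_eq lookup_zero zero_neq_one)
  then show ?thesis by (simp add: mfps_X_def mfps_monom_nth)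
qed

section \<open>Coefficients at integer exponent vectors\<close>

definition expo :: "nat set \<Rightarrow> (nat \<Rightarrow> int) \<Rightarrow> (nat \<Rightarrow>\<^sub>0 nat)" where
  "expo A a = Abs_poly_mapping (\<lambda>i. if i \<in> A then nat (a i) else 0)"

lemma lookup_expo:
  assumes "finite A"
  shows "Poly_Mapping.lookup (expo A a) i = (if i \<in> A then nat (a i) else 0)"
  unfolding expo_def
  by (subst lookup_Abs_poly_mapping) (rule finite_subset[OF _ assms], auto)

lemma keys_expo_subset: "finite A \<Longrightarrow> Poly_Mapping.keys (expo A a) \<subseteq> A"
  by (auto simp: in_keys_iff lookup_expo split: if_splits)

text \<open>Growth of columns lowers exponents, possibly below 0. The guard is needed because
  \<open>expo\<close> truncates negative values; the value 0 there is what later enforces bounds on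
  the heights.\<close>

definition mfps_coeff :: "nat set \<Rightarrow> 'a::comm_ring_1 mfps \<Rightarrow> (nat \<Rightarrow> int) \<Rightarrow> 'a" where
  "mfps_coeff A f a = (if \<forall>i\<in>A. 0 \<le> a i then mfps_nth f (expo A a) else 0)"

lemma mfps_coeff_cong:
  assumes "\<And>i. i \<in> A \<Longrightarrow> a i = b i"
  shows "mfps_coeff A f a = mfps_coeff A f b"
  using assms by (simp add: mfps_coeff_def expo_def cong: if_cong)

lemma mfps_coeff_linear:
  assumes A: "finite A" "c \<in> A"
  shows "mfps_coeff A ((1 + mfps_const w * mfps_X c) * f) a =
    mfps_coeff A f a + w * mfps_coeff A f (a(c := a c - 1))"
proof (cases "\<forall>i\<in>A. 0 \<le> a i")
  case True
  have *: "(1 + mfps_const w * mfps_X c) * f = f + mfps_const w * (mfps_X c * f)"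
    by (simp add: algebra_simps)
  show ?thesis
  proof (cases "a c = 0")
    case z: True
    then have "\<not> (\<forall>i\<in>A. 0 \<le> (a(c := a c - 1)) i)" using A by force
    then have "mfps_coeff A f (a(c := a c - 1)) = 0"
      unfolding mfps_coeff_def by (rule if_not_P)
    with z True A show ?thesis
      by (simp add: mfps_coeff_def * mfps_const_mult_nth mfps_X_mult_nth lookup_expo)
  next
    case nz: False
    with True A(2) have "a c \<ge> 1" by force
    then have ge: "\<forall>i\<in>A. 0 \<le> (a(c := a c - 1)) i" using True by simp
    have "expo A a - Poly_Mapping.single c 1 = expo A (a(c := a c - 1))"
      using \<open>a c \<ge> 1\<close> A
      by (intro poly_mapping_eqI) (auto simp: lookup_minus lookup_expo lookup_single when_def nat_diff_distrib)
    with True ge \<open>a c \<ge> 1\<close> A show ?thesis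
      by (simp add: mfps_coeff_def * mfps_const_mult_nth mfps_X_mult_nth lookup_expo del: fun_upd_apply)
  qed
next
  case False
  then obtain i where i: "i \<in> A" "a i < 0" by force
  then have "(a(c := a c - 1)) i < 0" by auto
  with i have *: "\<not> (\<forall>i\<in>A. 0 \<le> (a(c := a c - 1)) i)" by (meson not_le)
  show ?thesis unfolding mfps_coeff_def if_not_P[OF False] if_not_P[OF *] by simp
qed

text \<open>\<open>B\<close> records the factors from which the variable is taken instead of 1. Each
  variable has only one factor, so every exponent drops by at most 1.\<close>

lemma mfps_coeff_prod_linear:
  assumes A: "finite A" and D: "D \<subseteq> A"
  shows "mfps_coeff A ((\<Prod>c\<in>D. 1 + mfps_const (w c) * mfps_X c) * f) a =
    (\<Sum>B\<in>Pow D. (\<Prod>c\<in>B. w c) * mfps_coeff A f (\<lambda>i. a i - of_bool (i \<in> B)))"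
proof -
  have "finite D" using A D finite_subset by blast
  then show ?thesis using D
  proof (induction D arbitrary: a rule: finite_induct)
    case empty
    then show ?case by simp
  next
    case (insert c D)
    let ?L = "\<lambda>c. 1 + mfps_const (w c) * mfps_X c"
    have fin: "finite B" if "B \<in> Pow D" for B using that insert.hyps finite_subset by blast
    have upd: "(\<lambda>i. (a(c := a c - 1)) i - of_bool (i \<in> B)) = (\<lambda>i. a i - of_bool (i \<in> insert c B))"
      if "B \<in> Pow D" for B using that insert.hyps by (auto simp: fun_eq_iff)
    have "mfps_coeff A (prod ?L (insert c D) * f) a = mfps_coeff A (?L c * (prod ?L D * f)) a"
      using insert by (simp add: mult.assoc)
    also have "\<dots> = mfps_coeff A (prod ?L D * f) a + w c * mfps_coeff A (prod ?L D * f) (a(c := a c - 1))"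
      using insert A by (intro mfps_coeff_linear) auto
    also have "\<dots> = (\<Sum>B\<in>Pow D. (\<Prod>c\<in>B. w c) * mfps_coeff A f (\<lambda>i. a i - of_bool (i \<in> B))) +
        (\<Sum>B\<in>Pow D. (\<Prod>c\<in>insert c B. w c) * mfps_coeff A f (\<lambda>i. a i - of_bool (i \<in> insert c B)))"
    proof -
      have "(\<Prod>c\<in>insert c B. w c) = w c * (\<Prod>c\<in>B. w c)" if "B \<in> Pow D" for B
        using that insert.hyps fin[OF that] by (subst prod.insert) auto
      then show ?thesis using insert.IH insert.prems upd
        by (simp add: sum_distrib_left mult.assoc del: fun_upd_apply)
    qed
    also have "\<dots> = (\<Sum>B\<in>Pow (insert c D). (\<Prod>c\<in>B. w c) * mfps_coeff A f (\<lambda>i. a i - of_bool (i \<in> B)))"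
    proof -
      have "inj_on (insert c) (Pow D)" using insert.hyps by (auto simp: inj_on_def)
      moreover have "Pow D \<inter> insert c ` Pow D = {}" using insert.hyps by auto
      ultimately show ?thesis
        using insert.hyps by (simp add: Pow_insert sum.union_disjoint sum.reindex)
    qed
    finally show ?case .
  qed
qed

section \<open>Exchanging two variables\<close>

definition mfps_swap :: "nat \<Rightarrow> nat \<Rightarrow> 'a::comm_ring_1 mfps \<Rightarrow> 'a mfps" where
  "mfps_swap r s f = Abs_mfps (\<lambda>a. mfps_nth f (Poly_Mapping.map_key (transpose r s) a))"

lemma lookup_map_key_transpose [simp]:
  "Poly_Mapping.lookup (Poly_Mapping.map_key (transpose r s) a) i = Poly_Mapping.lookup a (transpose r s i)"
  by (simp add: map_key.rep_eq)

lemma map_key_transpose_involutory [simp]: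
  "Poly_Mapping.map_key (transpose r s) (Poly_Mapping.map_key (transpose r s) a) = a"
  by (rule poly_mapping_eqI) simp

lemma map_key_transpose_add:
  "Poly_Mapping.map_key (transpose r s) (a + b :: nat \<Rightarrow>\<^sub>0 nat) =
    Poly_Mapping.map_key (transpose r s) a + Poly_Mapping.map_key (transpose r s) b"
  by (rule poly_mapping_eqI) (simp add: lookup_add)

lemma mfps_swap_nth:
  "mfps_nth (mfps_swap r s f) a = mfps_nth f (Poly_Mapping.map_key (transpose r s) a)"
  by (simp add: mfps_swap_def)

lemma mfps_swap_add: "mfps_swap r s (f + g) = mfps_swap r s f + mfps_swap r s g"
  by (rule mfps_eqI) (simp add: mfps_swap_nth)

lemma mfps_swap_uminus: "mfps_swap r s (- f) = - mfps_swap r s f"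
  by (rule mfps_eqI) (simp add: mfps_swap_nth)

lemma mfps_swap_0: "mfps_swap r s 0 = 0"
  by (rule mfps_eqI) (simp add: mfps_swap_nth)

lemma mfps_swap_const: "mfps_swap r s (mfps_const c) = mfps_const c"
proof (rule mfps_eqI)
  fix a :: "nat \<Rightarrow>\<^sub>0 nat"
  have "Poly_Mapping.map_key (transpose r s) a = 0 \<longleftrightarrow> a = 0"
    by (metis lookup_map_key_transpose map_key_transpose_involutory lookup_zero poly_mapping_eqI)
  then show "mfps_nth (mfps_swap r s (mfps_const c)) a = mfps_nth (mfps_const c) a"
    by (simp add: mfps_swap_nth mfps_const_nth)
qed

lemma mfps_swap_1: "mfps_swap r s 1 = 1"
  using mfps_swap_const[of r s 1] by (simp add: mfps_const_1)

lemma mfps_swap_X: "mfps_swap r s (mfps_X i) = mfps_X (transpose r s i)"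
proof (rule mfps_eqI)
  fix a :: "nat \<Rightarrow>\<^sub>0 nat"
  have "Poly_Mapping.map_key (transpose r s) a = Poly_Mapping.single i 1 \<longleftrightarrow>
      a = Poly_Mapping.map_key (transpose r s) (Poly_Mapping.single i 1)"
    by (metis map_key_transpose_involutory)
  also have "Poly_Mapping.map_key (transpose r s) (Poly_Mapping.single i (1::nat)) =
      Poly_Mapping.single (transpose r s i) 1"
    by (rule poly_mapping_eqI) (auto simp: lookup_single when_def)
  finally show "mfps_nth (mfps_swap r s (mfps_X i)) a = mfps_nth (mfps_X (transpose r s i)) a"
    by (simp add: mfps_swap_nth mfps_X_def mfps_monom_nth)
qed

lemma mfps_swap_mult: "mfps_swap r s (f * g) = mfps_swap r s f * mfps_swap r s g"
proof (rule mfps_eqI)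
  fix k :: "nat \<Rightarrow>\<^sub>0 nat"
  let ?t = "Poly_Mapping.map_key (transpose r s)"
  show "mfps_nth (mfps_swap r s (f * g)) k = mfps_nth (mfps_swap r s f * mfps_swap r s g) k"
    unfolding mfps_swap_nth mfps_mult_nth
    by (rule sum.reindex_bij_witness[where i = "map_prod ?t ?t" and j = "map_prod ?t ?t"])
      (auto simp: splittings_def map_key_transpose_add[symmetric])
qed

lemma mfps_swap_prod: "mfps_swap r s (\<Prod>i\<in>I. f i) = (\<Prod>i\<in>I. mfps_swap r s (f i))"
  by (induction I rule: infinite_finite_induct) (simp_all add: mfps_swap_1 mfps_swap_mult)

lemma mfps_swap_sum: "mfps_swap r s (\<Sum>i\<in>I. f i) = (\<Sum>i\<in>I. mfps_swap r s (f i))"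
  by (induction I rule: infinite_finite_induct) (simp_all add: mfps_swap_0 mfps_swap_add)

text \<open>The exchange fixes the exponent vector, so the coefficient equals its own negative,
  which forces 0 in characteristic zero.\<close>

lemma mfps_coeff_antisymmetric_eq_0:
  fixes f :: "'a::{idom, ring_char_0} mfps"
  assumes A: "finite A" "r \<in> A" "s \<in> A"
    and f: "mfps_swap r s f = - f" and a: "a r = a s"
  shows "mfps_coeff A f a = 0"
proof -
  have "Poly_Mapping.map_key (transpose r s) (expo A a) = expo A a"
  proof (rule poly_mapping_eqI)
    fix i
    consider "i = r" | "i = s" | "i \<noteq> r" "i \<noteq> s" by blast
    then show "Poly_Mapping.lookup (Poly_Mapping.map_key (transpose r s) (expo A a)) i =
        Poly_Mapping.lookup (expo A a) i"
      by cases (simp_all add: lookup_expo A a)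
  qed
  then have "mfps_nth f (expo A a) = - mfps_nth f (expo A a)"
    by (metis f mfps_swap_nth mfps_uminus_nth)
  then show ?thesis by (simp add: mfps_coeff_def)
qed

section \<open>The alternant series\<close>

text \<open>The sum is the coefficient of degree \<open>card Y - 1\<close> in the Lagrange
  interpolant of \<open>p\<close> at \<open>Y\<close>. The interpolant is \<open>p\<close> itself,
  whose degree is smaller.\<close>

lemma sum_poly_over_node_differences_eq_0:
  fixes Y :: "'a::field set" and p :: "'a poly"
  assumes Y: "finite Y" and deg: "degree p + 1 < card Y"
  shows "(\<Sum>y\<in>Y. poly p y / (\<Prod>z\<in>Y - {y}. y - z)) = 0"
proof -
  define L where "L = (\<lambda>y. \<Prod>z\<in>Y - {y}. [:- z, 1:])"
  define c where "c = (\<lambda>y. poly p y / (\<Prod>z\<in>Y - {y}. y - z))"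
  define r where "r = (\<Sum>y\<in>Y. smult (c y) (L y))"
  have degL: "degree (L y) = card Y - 1" if "y \<in> Y" for y
    unfolding L_def using that Y by (subst degree_prod_sum_eq) auto
  have leadL: "coeff (L y) (card Y - 1) = 1" if "y \<in> Y" for y
  proof -
    have "lead_coeff (L y) = 1" by (simp add: L_def lead_coeff_prod)
    then show ?thesis by (simp add: degL[OF that])
  qed
  have "poly r y = poly p y" if y: "y \<in> Y" for y
  proof -
    have "poly (L z) y = 0" if "z \<in> Y - {y}" for z
      using that y Y by (simp add: L_def poly_prod) blast
    then have "poly r y = c y * poly (L y) y"
      unfolding r_def using y Y by (simp add: poly_sum sum.remove)
    also have "\<dots> = poly p y"
      using Y by (simp add: c_def L_def poly_prod)
    finally show ?thesis .
  qed
  moreover have "degree r < card Y"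
  proof -
    have "degree r \<le> card Y - 1"
      unfolding r_def using degL by (intro degree_sum_le[OF Y]) (simp add: degree_smult_le)
    then show ?thesis using deg by simp
  qed
  ultimately have "r = p"
    using Y deg by (intro poly_eqI_degree[of Y]) auto
  then have "coeff r (card Y - 1) = 0"
    using deg by (simp add: coeff_eq_0)
  then show ?thesis
    using leadL by (simp add: r_def c_def coeff_sum)
qed

text \<open>Partial fractions at the nodes 0, -1 and all \<open>x i\<close>, for the polynomial with
  value the product of the 1 - x_j y. Up to a common factor, the nodes \<open>x i\<close> give the
  sum, node -1 gives the product of the \<open>x i\<close>, and node 0 gives 1.\<close>

lemma sum_minor_weights:
  fixes x :: "'b \<Rightarrow> 'a::field"
  assumes A: "finite A" and inj: "inj_on x A"
    and nz: "\<And>i. i \<in> A \<Longrightarrow> x i \<noteq> 0" and nm: "\<And>i. i \<in> A \<Longrightarrow> x i \<noteq> -1"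
  shows "(\<Sum>i\<in>A. (1 - x i) * (\<Prod>j\<in>A - {i}. x j * (1 - x i * x j) / (x j - x i))) =
    1 - (\<Prod>i\<in>A. x i)"
proof -
  define p where "p = (\<Prod>j\<in>A. [:1, - x j:])"
  \<comment> \<open>Node -1 is added because \<open>p\<close> at \<open>x i\<close> contains the
    square term 1 - x_i^2, whose factor 1 + x_i has to cancel.\<close>
  define Y where "Y = insert 0 (insert (-1) (x ` A))"
  define e where "e = (\<Prod>i\<in>A. x i)"
  define s :: 'a where "s = (- 1) ^ card A"
  have e0: "e \<noteq> 0" using A nz by (simp add: e_def)
  have s2: "s * s = 1" by (simp add: s_def flip: power_add)
  have ss: "s \<noteq> 0" by (simp add: s_def)
  have Yf: "finite Y" using A by (simp add: Y_def)
  have nin: "0 \<notin> insert (-1) (x ` A)" "(-1) \<notin> x ` A" using nz nm by force+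
  have cardY: "card Y = card A + 2"
    using nin A inj by (simp add: Y_def card_image)
  have "degree p \<le> card A"
    unfolding p_def by (rule order.trans[OF degree_prod_sum_le[OF A]])
      (auto intro!: order.trans[OF sum_bounded_above[of A _ 1]])
  then have sum0: "(\<Sum>y\<in>Y. poly p y / (\<Prod>z\<in>Y - {y}. y - z)) = 0"
    by (intro sum_poly_over_node_differences_eq_0 Yf) (simp add: cardY)
  let ?t = "\<lambda>y. poly p y / (\<Prod>z\<in>Y - {y}. y - z)"
  have t0: "?t 0 = s / e"
  proof -
    have "Y - {0} = insert (-1) (x ` A)" using nin by (auto simp: Y_def)
    then have "(\<Prod>z\<in>Y - {0}. 0 - z) = (\<Prod>i\<in>A. - x i)"
      using nin A inj by (simp add: prod.reindex)
    also have "\<dots> = s * e" by (simp add: prod_uminus s_def e_def)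
    finally show ?thesis using s2 ss e0 by (simp add: p_def poly_prod field_simps)
  qed
  have t1: "?t (-1) = - s"
  proof -
    have "Y - {-1} = insert 0 (x ` A)" using nm by (auto simp: Y_def)
    then have "(\<Prod>z\<in>Y - {-1}. - 1 - z) = - (\<Prod>i\<in>A. - 1 - x i)"
      using nin A inj by (simp add: prod.reindex)
    also have "(\<Prod>i\<in>A. - 1 - x i) = (\<Prod>i\<in>A. - (1 + x i))" by (simp add: algebra_simps)
    also have "\<dots> = s * (\<Prod>i\<in>A. 1 + x i)" by (simp only: prod_uminus s_def)
    finally have *: "(\<Prod>z\<in>Y - {-1}. - 1 - z) = - (s * (\<Prod>i\<in>A. 1 + x i))" .
    have "(\<Prod>i\<in>A. 1 + x i) \<noteq> 0"
      using A nm by (simp add: add_eq_0_iff)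
    then show ?thesis unfolding * using s2 ss by (simp add: p_def poly_prod field_simps)
  qed
  define T where "T = (\<lambda>i. (1 - x i) * (\<Prod>j\<in>A - {i}. x j * (1 - x i * x j) / (x j - x i)))"
  \<comment> \<open>Here \<open>a\<close> stands for \<open>x i\<close>, and \<open>q\<close>,
    \<open>w\<close>, \<open>d\<close> for the products over the other j of \<open>x j\<close>,
    \<open>1 - x i * x j\<close> and \<open>x j - x i\<close>. The sign moves across by
    \<open>s * s = 1\<close>.\<close>
  have cancel: "a * q * ((1 - a) * (1 + a) * w / (a * ((a + 1) * (- s * d)))) = - s * ((1 - a) * (q * w / d))"
    if "a \<noteq> 0" "a + 1 \<noteq> 0" "d \<noteq> 0" for a q w d
  proof -
    define u where "u = q * w / d"
    have u: "q * w = u * d" using that(3) by (simp add: u_def)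
    have "- s * ((1 - a) * u) * (a * ((a + 1) * (- s * d))) = (s * s) * (a * ((1 - a) * (1 + a)) * (u * d))"
      by (simp add: algebra_simps)
    also have "\<dots> = (s * s) * (a * q * ((1 - a) * (1 + a) * w))"
      unfolding u[symmetric] by (simp only: ac_simps)
    finally have "- s * ((1 - a) * (q * w / d)) * (a * ((a + 1) * (- s * d))) =
        (s * s) * (a * q * ((1 - a) * (1 + a) * w))" unfolding u_def .
    moreover have "a * ((a + 1) * (- s * d)) \<noteq> 0" using that ss by simp
    ultimately show ?thesis
      unfolding times_divide_eq_right[of "a * q"] s2 mult_1_left by (metis nonzero_divide_eq_eq)
  qed
  have ti: "e * ?t (x i) = - s * ((1 - x i) * (\<Prod>j\<in>A - {i}. x j * (1 - x i * x j) / (x j - x i)))"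
    if i: "i \<in> A" for i
  proof -
    let ?Z = "insert 0 (insert (-1) (x ` (A - {i})))"
    have "Y = insert (x i) ?Z" using i by (auto simp: Y_def)
    moreover have "x i \<notin> x ` (A - {i})"
      using i inj by (simp add: inj_on_image_mem_iff)
    then have "x i \<notin> ?Z" using nz[OF i] nm[OF i] by simp
    ultimately have "Y - {x i} = ?Z" by (metis Diff_insert_absorb)
    then have "(\<Prod>z\<in>Y - {x i}. x i - z) = x i * ((x i + 1) * (\<Prod>j\<in>A - {i}. x i - x j))"
      using nin A inj_on_subset[OF inj, of "A - {i}"] by (simp add: prod.reindex image_iff)
    also have "(\<Prod>j\<in>A - {i}. x i - x j) = (\<Prod>j\<in>A - {i}. - (x j - x i))" by simp
    \<comment> \<open>There are \<open>card A - 1\<close> sign changes, one fewer than in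
      \<open>s\<close>.\<close>
    also have "\<dots> = - s * (\<Prod>j\<in>A - {i}. x j - x i)"
      unfolding prod_uminus using A i by (cases "card A") (auto simp: s_def card_Diff_singleton)
    finally have *: "(\<Prod>z\<in>Y - {x i}. x i - z) = x i * ((x i + 1) * (- s * (\<Prod>j\<in>A - {i}. x j - x i)))" .
    have pp: "poly p (x i) = (1 - x i) * (1 + x i) * (\<Prod>j\<in>A - {i}. 1 - x i * x j)"
      using A i by (simp add: p_def poly_prod prod.remove algebra_simps)
    have ee: "e = x i * (\<Prod>j\<in>A - {i}. x j)"
      using A i by (simp add: e_def prod.remove)
    have D: "(\<Prod>j\<in>A - {i}. x j - x i) \<noteq> 0"
      using A i inj by (auto simp: inj_on_def)
    have "x i \<noteq> 0" "x i + 1 \<noteq> 0" using nz nm i by (simp_all add: eq_neg_iff_add_eq_0)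
    then show ?thesis
      unfolding * pp ee prod_dividef prod.distrib by (rule cancel) (rule D)
  qed
  have "(\<Sum>y\<in>Y. ?t y) = ?t 0 + (?t (-1) + (\<Sum>i\<in>A. ?t (x i)))"
    using nin A inj by (simp add: Y_def sum.reindex)
  then have "0 = e * (?t 0 + (?t (-1) + (\<Sum>i\<in>A. ?t (x i))))" using sum0 by simp
  also have "\<dots> = e * ?t 0 + e * ?t (-1) + (\<Sum>i\<in>A. e * ?t (x i))"
    by (simp only: distrib_left sum_distrib_left add.assoc)
  also have "\<dots> = e * (s / e) + e * (- s) + (\<Sum>i\<in>A. - s * T i)"
    unfolding t0 t1 T_def by (simp only: ti cong: sum.cong)
  also have "\<dots> = s * (1 - e - sum T A)"
    using e0 by (simp add: algebra_simps sum_negf flip: sum_distrib_left)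
  finally show ?thesis using ss by (simp add: e_def T_def)
qed

definition ordered_pairs :: "nat set \<Rightarrow> (nat \<times> nat) set" where
  "ordered_pairs A = {(i, j). i \<in> A \<and> j \<in> A \<and> i < j}"

lemma finite_ordered_pairs [simp]: "finite A \<Longrightarrow> finite (ordered_pairs A)"
  by (rule finite_subset[of _ "A \<times> A"]) (auto simp: ordered_pairs_def)

lemma prod_ordered_pairs_remove:
  assumes "finite A" "i \<in> A"
  shows "(\<Prod>(j, l)\<in>ordered_pairs A. g j l) =
    (\<Prod>(j, l)\<in>ordered_pairs (A - {i}). g j l) *
    ((\<Prod>j\<in>{j\<in>A. j < i}. g j i) * (\<Prod>j\<in>{j\<in>A. i < j}. g i j))"
proof -
  have eq: "ordered_pairs A = ordered_pairs (A - {i}) \<union>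
      ((\<lambda>j. (j, i)) ` {j\<in>A. j < i} \<union> Pair i ` {j\<in>A. i < j})"
    using assms(2) by (auto simp: ordered_pairs_def)
  have "finite (ordered_pairs (A - {i}))" using assms(1) by simp
  then show ?thesis
    unfolding eq using assms(1)
    by (subst prod.union_disjoint; (subst prod.union_disjoint)?)
      (auto simp: ordered_pairs_def prod.reindex inj_on_def)
qed

definition alternant_coeff :: "nat set \<Rightarrow> (nat \<Rightarrow> nat) \<Rightarrow> int" where
  "alternant_coeff A a = (\<Prod>(i, j)\<in>ordered_pairs A. sgn (int (a j) - int (a i)))"

text \<open>The product of signs is the sign of the permutation that sorts the exponents, and 0 if
  two of them agree. So this is the sum of the alternants of all strict exponent sequences.\<close>

definition alternant_series :: "nat set \<Rightarrow> 'a::comm_ring_1 mfps" where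
  "alternant_series A = Abs_mfps (\<lambda>a. if Poly_Mapping.keys a \<subseteq> A
     then of_int (alternant_coeff A (Poly_Mapping.lookup a)) else 0)"

lemma alternant_series_nth:
  "mfps_nth (alternant_series A) a = (if Poly_Mapping.keys a \<subseteq> A
     then of_int (alternant_coeff A (Poly_Mapping.lookup a)) else 0)"
  by (simp add: alternant_series_def)

lemma alternant_coeff_eq_0:
  assumes "finite A" "i \<in> A" "j \<in> A" "i \<noteq> j" "a i = a j"
  shows "alternant_coeff A a = 0"
proof -
  have "(min i j, max i j) \<in> ordered_pairs A"
    using assms by (auto simp: ordered_pairs_def min_def max_def)
  moreover have "a (min i j) = a (max i j)" using assms(5) by (simp add: min_def max_def)
  ultimately show ?thesis
    unfolding alternant_coeff_def using assms(1) by (auto intro!: bexI[of _ "(min i j, max i j)"])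
qed

lemma alternant_coeff_strict_mono:
  assumes "\<And>i j. i \<in> A \<Longrightarrow> j \<in> A \<Longrightarrow> i < j \<Longrightarrow> a i < a j"
  shows "alternant_coeff A a = 1"
  unfolding alternant_coeff_def using assms
  by (intro prod.neutral) (auto simp: ordered_pairs_def)

lemma alternant_coeff_cong:
  assumes "\<And>i j. i \<in> A \<Longrightarrow> j \<in> A \<Longrightarrow> int (a j) - int (a i) = int (b j) - int (b i)"
  shows "alternant_coeff A a = alternant_coeff A b"
  unfolding alternant_coeff_def using assms
  by (intro prod.cong) (auto simp: ordered_pairs_def)

text \<open>The exponent 0 is the smallest, so of the pairs containing i just those with i as the
  larger index contribute -1.\<close>

lemma alternant_coeff_remove_zero:
  assumes A: "finite A" "i \<in> A" and z: "a i = 0" and pos: "\<And>j. j \<in> A - {i} \<Longrightarrow> a j > 0"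
  shows "alternant_coeff A a = (- 1) ^ card {j\<in>A. j < i} * alternant_coeff (A - {i}) a"
proof -
  have "(\<Prod>j\<in>{j\<in>A. j < i}. sgn (int (a i) - int (a j))) = (\<Prod>j\<in>{j\<in>A. j < i}. - 1)"
    using z pos by (intro prod.cong) auto
  moreover have "(\<Prod>j\<in>{j\<in>A. i < j}. sgn (int (a j) - int (a i))) = 1"
    using z pos by (intro prod.neutral) auto
  ultimately show ?thesis
    unfolding alternant_coeff_def prod_ordered_pairs_remove[OF A] by simp
qed

definition ones :: "nat set \<Rightarrow> (nat \<Rightarrow>\<^sub>0 nat)" where
  "ones A = expo A (\<lambda>_. 1)"

lemma lookup_ones: "finite A \<Longrightarrow> Poly_Mapping.lookup (ones A) i = (if i \<in> A then 1 else 0)"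
  by (simp add: ones_def lookup_expo)

lemma prod_mfps_X: "finite A \<Longrightarrow> (\<Prod>i\<in>A. mfps_X i) = mfps_monom (ones A)"
proof (induction A rule: finite_induct)
  case empty
  have "ones {} = 0" by (rule poly_mapping_eqI) (simp add: lookup_ones)
  then show ?case by (simp add: mfps_monom_0)
next
  case (insert i A)
  have "Poly_Mapping.single i 1 + ones A = ones (insert i A)"
    using insert by (intro poly_mapping_eqI) (auto simp: lookup_add lookup_ones lookup_single when_def)
  with insert show ?case by (simp add: mfps_X_def mfps_monom_mult)
qed

text \<open>
  An exponent vector without zeros is shifted down without changing its coefficient, and
  one with two zeros has coefficient 0.
\<close>

lemma alternant_series_recursion:
  assumes A: "finite A"
  shows "(1 - (\<Prod>i\<in>A. mfps_X i)) * alternant_series A =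
    (\<Sum>i\<in>A. (- 1) ^ card {j\<in>A. j < i} * ((\<Prod>j\<in>A - {i}. mfps_X j) * alternant_series (A - {i})) :: 'a::comm_ring_1 mfps)"
proof (rule mfps_eqI)
  fix b :: "nat \<Rightarrow>\<^sub>0 nat"
  let ?S = "alternant_series :: nat set \<Rightarrow> 'a mfps"
  let ?lk = Poly_Mapping.lookup
  let ?s = "\<lambda>i. (- 1) ^ card {j\<in>A. j < i}"
  have ones_le: "(\<forall>i. ?lk (ones D) i \<le> ?lk b i) \<longleftrightarrow> (\<forall>i\<in>D. 0 < ?lk b i)" if "finite D" for D
    using that by (auto simp: lookup_ones Suc_le_eq)
  have lk: "?lk (b - ones D) i = ?lk b i - (if i \<in> D then 1 else 0)" if "finite D" for D i
    using that by (simp add: lookup_minus lookup_ones)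
  have sgn: "mfps_nth ((- 1) ^ e * f) b = (- 1) ^ e * mfps_nth f b" for e and f :: "'a mfps"
    by (cases "even e") auto
  \<comment> \<open>\<open>L\<close> and the signed sum of the \<open>R i\<close> are the
    coefficients of the two sides at \<open>b\<close>. The monomials in front shift \<open>b\<close>
    down, or give 0 where it has no room.\<close>
  define L where "L = mfps_nth (?S A) b -
    (if \<forall>i\<in>A. 0 < ?lk b i then mfps_nth (?S A) (b - ones A) else 0)"
  define R where "R = (\<lambda>i. if \<forall>j\<in>A - {i}. 0 < ?lk b j
    then mfps_nth (?S (A - {i})) (b - ones (A - {i})) else 0)"
  have "L = (\<Sum>i\<in>A. ?s i * R i)"
  proof (cases "Poly_Mapping.keys b \<subseteq> A")
    case False
    then obtain l where l: "l \<in> Poly_Mapping.keys b" "l \<notin> A" by blast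
    then have "l \<in> Poly_Mapping.keys (b - ones D)" if "D \<subseteq> A" for D
      using that finite_subset[OF that A] by (auto simp: in_keys_iff lk)
    then have "\<not> Poly_Mapping.keys (b - ones D) \<subseteq> A" if "D \<subseteq> A" for D
      using that l by blast
    then have "L = 0" "R i = 0" for i
      using False unfolding L_def R_def alternant_series_nth by (auto split: if_splits)
    then show ?thesis by simp
  next
    case sub: True
    show ?thesis
    proof (cases "\<forall>i\<in>A. 0 < ?lk b i")
      case True
      \<comment> \<open>After the shift the exponent at i is still positive, while the series of
        \<open>A - {i}\<close> does not involve that variable.\<close>
      have "R i = 0" if "i \<in> A" for i
      proof -
        have "i \<in> Poly_Mapping.keys (b - ones (A - {i}))"
          using that True A by (auto simp: in_keys_iff lk)
        then show ?thesis unfolding R_def alternant_series_nth by auto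
      qed
      moreover have "L = 0"
      proof -
        have "Poly_Mapping.keys (b - ones A) \<subseteq> A"
          using sub A by (auto simp: in_keys_iff lk)
        moreover have "alternant_coeff A (?lk b) = alternant_coeff A (?lk (b - ones A))"
          using True A by (intro alternant_coeff_cong) (auto simp: lk Suc_le_eq of_nat_diff)
        ultimately show ?thesis using True sub by (simp add: L_def alternant_series_nth)
      qed
      ultimately show ?thesis by simp
    next
      case False
      then obtain i where i: "i \<in> A" "?lk b i = 0" by auto
      have L: "L = mfps_nth (?S A) b" unfolding L_def if_not_P[OF False] by simp
      \<comment> \<open>For j other than i the monomial in front contains the variable i, which
        \<open>b\<close> lacks.\<close>
      have Rj: "R j = 0" if "j \<in> A - {i}" for j
      proof -
        have "\<not> (\<forall>l\<in>A - {j}. 0 < ?lk b l)"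
          using that i by (auto intro!: bexI[of _ i])
        then show ?thesis unfolding R_def by (rule if_not_P)
      qed
      have "(\<Sum>j\<in>A. ?s j * R j) = ?s i * R i"
        using A i Rj by (simp add: sum.remove)
      also have "\<dots> = L"
      proof (cases "\<forall>j\<in>A - {i}. 0 < ?lk b j")
        case True
        have "Poly_Mapping.keys (b - ones (A - {i})) \<subseteq> A - {i}"
          using sub A i by (auto simp: in_keys_iff lk split: if_splits)
        moreover have "alternant_coeff (A - {i}) (?lk b) =
            alternant_coeff (A - {i}) (?lk (b - ones (A - {i})))"
          using True A by (intro alternant_coeff_cong) (auto simp: lk Suc_le_eq of_nat_diff)
        ultimately show ?thesis
          using True sub alternant_coeff_remove_zero[of A i "?lk b"] A i
          by (simp add: L R_def alternant_series_nth)
      next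
        case F: False
        then obtain j where j: "j \<in> A" "j \<noteq> i" "?lk b j = 0" by auto
        then have "alternant_coeff A (?lk b) = 0"
          using alternant_coeff_eq_0[of A i j "?lk b"] A i by simp
        then show ?thesis using sub unfolding R_def if_not_P[OF F] L
          by (simp add: alternant_series_nth)
      qed
      finally show ?thesis by simp
    qed
  qed
  moreover have "mfps_nth ((1 - (\<Prod>i\<in>A. mfps_X i)) * ?S A) b = L"
    using A ones_le[OF A] by (simp add: L_def left_diff_distrib prod_mfps_X mfps_monom_mult_nth)
  moreover have "mfps_nth (\<Sum>i\<in>A. ?s i * ((\<Prod>j\<in>A - {i}. mfps_X j) * ?S (A - {i}))) b = (\<Sum>i\<in>A. ?s i * R i)"
  proof -
    have nth_sum: "mfps_nth (\<Sum>i\<in>D. f i) b = (\<Sum>i\<in>D. mfps_nth (f i) b)" for D :: "nat set" and f :: "nat \<Rightarrow> 'a mfps"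
      by (induction D rule: infinite_finite_induct) simp_all
    show ?thesis
      unfolding nth_sum sgn
      using A ones_le by (intro sum.cong) (simp_all add: R_def prod_mfps_X mfps_monom_mult_nth)
  qed
  ultimately show "mfps_nth ((1 - (\<Prod>i\<in>A. mfps_X i)) * ?S A) b =
     mfps_nth (\<Sum>i\<in>A. ?s i * ((\<Prod>j\<in>A - {i}. mfps_X j) * ?S (A - {i}))) b"
    by simp
qed

lemma lookup_map_key_transpose_eq:
  "Poly_Mapping.lookup (Poly_Mapping.map_key (transpose r s) a) =
    (\<lambda>i. Poly_Mapping.lookup a (transpose r s i))"
  by (rule ext) simp

lemma keys_map_key_transpose_subset:
  "Poly_Mapping.keys (Poly_Mapping.map_key (transpose r s) a) \<subseteq> A \<longleftrightarrow>
    Poly_Mapping.keys a \<subseteq> transpose r s ` A"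
proof -
  have "i \<in> transpose r s ` A \<longleftrightarrow> transpose r s i \<in> A" for i
    by (metis image_eqI imageE transpose_involutory)
  then have "Poly_Mapping.keys a \<subseteq> transpose r s ` A \<longleftrightarrow>
      (\<forall>i. Poly_Mapping.lookup a i \<noteq> 0 \<longrightarrow> transpose r s i \<in> A)"
    by (auto simp: subset_iff in_keys_iff)
  also have "\<dots> \<longleftrightarrow> (\<forall>i. Poly_Mapping.lookup a (transpose r s i) \<noteq> 0 \<longrightarrow> i \<in> A)"
    by (metis transpose_involutory)
  finally show ?thesis by (auto simp: subset_iff in_keys_iff)
qed

text \<open>Reversing no other pair is the advantage of neighbouring indices, and the reason why
  only these are ever exchanged.\<close>

lemma transpose_Suc_less:
  assumes "i < j" "(i, j) \<noteq> (r, Suc r)"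
  shows "transpose r (Suc r) i < transpose r (Suc r) j"
  using assms by (auto simp: transpose_def)

text \<open>If at most one of the two indices is present, the exchange preserves the order of
  \<open>A\<close>, so the variables are merely renamed.\<close>

lemma mfps_swap_alternant_series_image:
  assumes "\<not> (r \<in> A \<and> Suc r \<in> A)"
  shows "mfps_swap r (Suc r) (alternant_series A) = alternant_series (transpose r (Suc r) ` A)"
proof (rule mfps_eqI)
  fix a :: "nat \<Rightarrow>\<^sub>0 nat"
  let ?t = "transpose r (Suc r)"
  have 1: "(?t i, ?t j) \<in> ordered_pairs (?t ` A)" if "(i, j) \<in> ordered_pairs A" for i j
    using that assms transpose_Suc_less[of i j r] by (auto simp: ordered_pairs_def)
  have 2: "(?t i, ?t j) \<in> ordered_pairs A" if ij: "(i, j) \<in> ordered_pairs (?t ` A)" for i j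
  proof -
    have A: "?t i \<in> A" "?t j \<in> A" and "i < j" using ij by (auto simp: ordered_pairs_def)
    moreover have "(i, j) \<noteq> (r, Suc r)" using A assms by auto
    ultimately show ?thesis using transpose_Suc_less[of i j r] by (simp add: ordered_pairs_def)
  qed
  have "alternant_coeff A (\<lambda>i. Poly_Mapping.lookup a (?t i)) = alternant_coeff (?t ` A) (Poly_Mapping.lookup a)"
    unfolding alternant_coeff_def
    by (rule prod.reindex_bij_witness[where i = "map_prod ?t ?t" and j = "map_prod ?t ?t"])
      (use 1 2 in auto)
  then show "mfps_nth (mfps_swap r (Suc r) (alternant_series A) :: 'a mfps) a =
      mfps_nth (alternant_series (?t ` A)) a"
    by (simp add: mfps_swap_nth alternant_series_nth keys_map_key_transpose_subset
        lookup_map_key_transpose_eq)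
qed

text \<open>The pair \<open>(r, Suc r)\<close> changes its sign; the other ordered pairs are
  permuted among themselves.\<close>

lemma mfps_swap_alternant_series:
  assumes A: "finite A" "r \<in> A" "Suc r \<in> A"
  shows "mfps_swap r (Suc r) (alternant_series A) = - alternant_series A"
proof (rule mfps_eqI)
  fix a :: "nat \<Rightarrow>\<^sub>0 nat"
  let ?t = "transpose r (Suc r)"
  let ?g = "\<lambda>(i, j). sgn (int (Poly_Mapping.lookup a j) - int (Poly_Mapping.lookup a i))"
  let ?R = "ordered_pairs A - {(r, Suc r)}"
  have tA: "?t ` A = A" using A by (simp add: transpose_image_eq)
  have mem: "?t i \<in> A \<longleftrightarrow> i \<in> A" for i
    using A by (auto simp: transpose_def)
  have 1: "map_prod ?t ?t p \<in> ?R" if "p \<in> ?R" for p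
  proof -
    obtain i j where ij: "p = (i, j)" by (cases p)
    with that have p: "p = (i, j)" "i \<in> A" "j \<in> A" "i < j" "(i, j) \<noteq> (r, Suc r)"
      by (auto simp: ordered_pairs_def)
    then have "(?t i, ?t j) \<noteq> (r, Suc r)"
      by (auto simp: transpose_def split: if_splits)
    with p show ?thesis using transpose_Suc_less[of i j r] by (simp add: ordered_pairs_def mem)
  qed
  have pr: "(r, Suc r) \<in> ordered_pairs A" using A by (simp add: ordered_pairs_def)
  have sgn_swap: "sgn (int (Poly_Mapping.lookup a r) - int (Poly_Mapping.lookup a (Suc r))) =
      - sgn (int (Poly_Mapping.lookup a (Suc r)) - int (Poly_Mapping.lookup a r))"
    by (simp add: sgn_if)
  have "alternant_coeff A (\<lambda>i. Poly_Mapping.lookup a (?t i)) =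
      - ?g (r, Suc r) * (\<Prod>p\<in>?R. ?g (map_prod ?t ?t p))"
    unfolding alternant_coeff_def prod.remove[OF finite_ordered_pairs[OF A(1)] pr]
    using sgn_swap by (simp add: case_prod_unfold)
  also have "(\<Prod>p\<in>?R. ?g (map_prod ?t ?t p)) = (\<Prod>p\<in>?R. ?g p)"
    by (rule prod.reindex_bij_witness[where i = "map_prod ?t ?t" and j = "map_prod ?t ?t"])
      (use 1 in \<open>auto simp del: map_prod_simp simp: map_prod_def case_prod_unfold\<close>)
  also have "- ?g (r, Suc r) * \<dots> = - alternant_coeff A (Poly_Mapping.lookup a)"
    unfolding alternant_coeff_def prod.remove[OF finite_ordered_pairs[OF A(1)] pr] by simp
  finally show "mfps_nth (mfps_swap r (Suc r) (alternant_series A) :: 'a mfps) a =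
      mfps_nth (- alternant_series A) a"
    by (simp add: mfps_swap_nth alternant_series_nth keys_map_key_transpose_subset
        lookup_map_key_transpose_eq tA)
qed

section \<open>The alternant series as a fraction\<close>

lemma mfps_fract_0: "mfps_fract 0 = 0"
  and mfps_fract_1: "mfps_fract 1 = 1"
  and mfps_fract_add: "mfps_fract (f + g) = mfps_fract f + mfps_fract g"
  and mfps_fract_diff: "mfps_fract (f - g) = mfps_fract f - mfps_fract g"
  and mfps_fract_uminus: "mfps_fract (- f) = - mfps_fract f"
  by (simp_all add: mfps_fract_def Zero_fract_def One_fract_def)

lemma mfps_fract_eq_0_iff: "mfps_fract f = 0 \<longleftrightarrow> f = 0"
  by (metis mfps_fract_0 mfps_fract_eq_iff)

lemma mfps_fract_power: "mfps_fract (f ^ e) = mfps_fract f ^ e"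
  by (induction e) (simp_all add: mfps_fract_1 mfps_fract_mult)

lemma mfps_fract_prod: "mfps_fract (\<Prod>i\<in>I. f i) = (\<Prod>i\<in>I. mfps_fract (f i))"
  by (induction I rule: infinite_finite_induct) (simp_all add: mfps_fract_1 mfps_fract_mult)

lemma mfps_fract_sum: "mfps_fract (\<Sum>i\<in>I. f i) = (\<Sum>i\<in>I. mfps_fract (f i))"
  by (induction I rule: infinite_finite_induct) (simp_all add: mfps_fract_0 mfps_fract_add)

lemmas mfps_fract_simps = mfps_fract_0 mfps_fract_1 mfps_fract_add mfps_fract_diff
  mfps_fract_uminus mfps_fract_mult mfps_fract_power mfps_fract_prod mfps_fract_sum

lemma x_var_eq: "x_var i = mfps_fract (mfps_X i)"
  by (simp add: x_var_def mfps_X_def)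

lemma mfps_X_inject: "(mfps_X i :: 'a::comm_ring_1 mfps) = mfps_X j \<longleftrightarrow> i = j"
proof
  assume "(mfps_X i :: 'a mfps) = mfps_X j"
  then have "mfps_nth (mfps_X i :: 'a mfps) (Poly_Mapping.single j 1) = 1"
    by (simp add: mfps_X_def mfps_monom_nth)
  then have "Poly_Mapping.single j (1::nat) = Poly_Mapping.single i 1"
    by (auto simp: mfps_X_def mfps_monom_nth split: if_splits)
  then show "i = j" by (metis lookup_single_eq lookup_single_not_eq zero_neq_one)
qed simp

lemma mfps_nonzero_constant: "mfps_nth f 0 \<noteq> 0 \<Longrightarrow> f \<noteq> 0"
  by auto

lemma x_var_inject: "x_var i = x_var j \<longleftrightarrow> i = j"
  by (simp add: x_var_eq mfps_fract_eq_iff mfps_X_inject)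

lemma x_var_neq_0: "x_var i \<noteq> 0"
proof -
  have "mfps_nth (mfps_X i :: int poly mfps) (Poly_Mapping.single i 1) \<noteq> 0"
    by (simp add: mfps_X_def mfps_monom_nth)
  then have "(mfps_X i :: int poly mfps) \<noteq> 0" by (metis mfps_zero_nth)
  then show ?thesis by (simp add: x_var_eq mfps_fract_eq_0_iff)
qed

lemma one_plus_x_var_neq_0: "1 + x_var i \<noteq> 0"
proof -
  have "(1 + mfps_X i :: int poly mfps) \<noteq> 0"
    by (rule mfps_nonzero_constant) (simp add: mfps_one_nth)
  then show ?thesis unfolding x_var_eq by (metis mfps_fract_1 mfps_fract_add mfps_fract_eq_0_iff)
qed

lemma one_minus_x_var_neq_0: "1 - x_var i \<noteq> 0"
proof -
  have "(1 - mfps_X i :: int poly mfps) \<noteq> 0"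
    by (rule mfps_nonzero_constant) (simp add: mfps_one_nth)
  then show ?thesis unfolding x_var_eq by (metis mfps_fract_1 mfps_fract_diff mfps_fract_eq_0_iff)
qed

lemma one_minus_x_var_mult_neq_0: "1 - x_var i * x_var j \<noteq> 0"
proof -
  have "(1 - mfps_X i * mfps_X j :: int poly mfps) \<noteq> 0"
    by (rule mfps_nonzero_constant) (simp add: mfps_one_nth mfps_nth_mult_0)
  then show ?thesis unfolding x_var_eq
    by (metis mfps_fract_1 mfps_fract_diff mfps_fract_mult mfps_fract_eq_0_iff)
qed

lemma one_minus_prod_x_var_neq_0:
  assumes "finite A" "A \<noteq> {}"
  shows "1 - (\<Prod>i\<in>A. x_var i) \<noteq> 0"
proof -
  obtain i where i: "i \<in> A" using assms by blast
  have "mfps_nth (\<Prod>i\<in>A. mfps_X i :: int poly mfps) 0 = 0"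
    unfolding prod.remove[OF assms(1) i] mfps_nth_mult_0 by simp
  then have "(1 - (\<Prod>i\<in>A. mfps_X i) :: int poly mfps) \<noteq> 0"
    by (intro mfps_nonzero_constant) (simp add: mfps_one_nth)
  then have "mfps_fract (1 - (\<Prod>i\<in>A. mfps_X i) :: int poly mfps) \<noteq> 0"
    by (simp add: mfps_fract_eq_0_iff)
  then show ?thesis by (simp add: mfps_fract_simps x_var_eq)
qed

definition alternant_fract :: "nat set \<Rightarrow> int poly mfps fract" where
  "alternant_fract A = (\<Prod>i\<in>A. inverse (1 - x_var i)) *
     (\<Prod>(i, j)\<in>ordered_pairs A. (x_var j - x_var i) / (1 - x_var i * x_var j))"

text \<open>The multiplier is the summand of R without its power of 1 + x_i. It cancels every factor
  that contains x_i; the sign comes from the j < i, where the product has x_i - x_j and the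
  multiplier divides by x_j - x_i.\<close>

lemma alternant_fract_remove:
  assumes A: "finite A" "i \<in> A"
  shows "(- 1) ^ card {j\<in>A. j < i} * alternant_fract (A - {i}) =
    alternant_fract A * ((1 - x_var i) *
      (\<Prod>j\<in>A - {i}. (1 - x_var i * x_var j) / (x_var j - x_var i)))"
proof -
  let ?g = "\<lambda>i j. (x_var j - x_var i) / (1 - x_var i * x_var j)"
  let ?h = "\<lambda>j. (1 - x_var i * x_var j) / (x_var j - x_var i)"
  let ?B = "{j\<in>A. j < i}" and ?C = "{j\<in>A. i < j}"
  define V where "V = (\<Prod>j\<in>A - {i}. inverse (1 - x_var j))"
  define W where "W = (\<Prod>(j, l)\<in>ordered_pairs (A - {i}). ?g j l)"
  have ne: "x_var j - x_var l \<noteq> 0" if "j \<noteq> l" for j l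
    using that by (simp add: x_var_inject)
  have BC: "A - {i} = ?B \<union> ?C" by auto
  have h: "(\<Prod>j\<in>A - {i}. ?h j) = (\<Prod>j\<in>?B. ?h j) * (\<Prod>j\<in>?C. ?h j)"
    unfolding BC by (rule prod.union_disjoint) (use A in auto)
  have "(\<Prod>j\<in>?B. ?g j i) * (\<Prod>j\<in>?B. ?h j) = (\<Prod>j\<in>?B. - 1)"
    unfolding prod.distrib[symmetric]
  proof (intro prod.cong refl)
    fix j assume "j \<in> ?B"
    then have "j \<noteq> i" by simp
    have "?g j i * ?h j = (x_var i - x_var j) / (x_var j - x_var i)"
      using one_minus_x_var_mult_neq_0[of i j] by (simp add: mult.commute)
    also have "\<dots> = - 1" using ne[OF \<open>j \<noteq> i\<close>] by (simp add: divide_eq_eq)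
    finally show "?g j i * ?h j = - 1" .
  qed
  then have B: "(\<Prod>j\<in>?B. ?g j i) * (\<Prod>j\<in>?B. ?h j) = (- 1) ^ card ?B" by simp
  have C: "(\<Prod>j\<in>?C. ?g i j) * (\<Prod>j\<in>?C. ?h j) = 1"
    unfolding prod.distrib[symmetric]
    using one_minus_x_var_mult_neq_0 ne by (intro prod.neutral ballI) simp
  have "alternant_fract A = inverse (1 - x_var i) * V * (W * ((\<Prod>j\<in>?B. ?g j i) * (\<Prod>j\<in>?C. ?g i j)))"
    using A prod_ordered_pairs_remove[OF A, of ?g]
    by (simp add: alternant_fract_def V_def W_def prod.remove)
  then have "alternant_fract A * ((1 - x_var i) * (\<Prod>j\<in>A - {i}. ?h j)) =
      (inverse (1 - x_var i) * (1 - x_var i)) * (V * W) *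
      (((\<Prod>j\<in>?B. ?g j i) * (\<Prod>j\<in>?B. ?h j)) * ((\<Prod>j\<in>?C. ?g i j) * (\<Prod>j\<in>?C. ?h j)))"
    unfolding h by (simp only: ac_simps)
  also have "\<dots> = (- 1) ^ card ?B * alternant_fract (A - {i})"
    unfolding B C using one_minus_x_var_neq_0[of i]
    by (simp add: alternant_fract_def V_def W_def)
  finally show ?thesis by simp
qed

lemma alternant_series_empty: "alternant_series {} = 1"
  by (rule mfps_eqI) (auto simp: alternant_series_nth mfps_one_nth alternant_coeff_def ordered_pairs_def)

text \<open>Both sides satisfy the recursion over deleted variables: the series by shifting
  exponents, the fraction by \<open>sum_minor_weights\<close>. The factor in front is nonzero for
  nonempty \<open>A\<close> and can be cancelled.\<close>

lemma mfps_fract_alternant_series: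
  "finite A \<Longrightarrow> mfps_fract (alternant_series A) = alternant_fract A"
proof (induction A rule: finite_psubset_induct)
  case (psubset A)
  show ?case
  proof (cases "A = {}")
    case True
    then show ?thesis
      by (simp add: alternant_series_empty alternant_fract_def ordered_pairs_def mfps_fract_1)
  next
    case False
    let ?D = "1 - (\<Prod>i\<in>A. x_var i)"
    let ?h = "\<lambda>i. \<Prod>j\<in>A - {i}. (1 - x_var i * x_var j) / (x_var j - x_var i)"
    have "?D * mfps_fract (alternant_series A) =
        mfps_fract ((1 - (\<Prod>i\<in>A. mfps_X i)) * alternant_series A)"
      by (simp add: mfps_fract_simps x_var_eq)
    also have "\<dots> = (\<Sum>i\<in>A. (- 1) ^ card {j\<in>A. j < i} *
        ((\<Prod>j\<in>A - {i}. x_var j) * alternant_fract (A - {i})))"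
      unfolding alternant_series_recursion[OF psubset.hyps] mfps_fract_simps x_var_eq[symmetric]
      by (intro sum.cong refl arg_cong2[of _ _ _ _ "(*)"] psubset.IH) auto
    also have "\<dots> = (\<Sum>i\<in>A. alternant_fract A * ((1 - x_var i) *
        (\<Prod>j\<in>A - {i}. x_var j * (1 - x_var i * x_var j) / (x_var j - x_var i))))"
    proof (rule sum.cong[OF refl])
      fix i assume i: "i \<in> A"
      have "(- 1) ^ card {j\<in>A. j < i} * ((\<Prod>j\<in>A - {i}. x_var j) * alternant_fract (A - {i})) =
          (\<Prod>j\<in>A - {i}. x_var j) * ((- 1) ^ card {j\<in>A. j < i} * alternant_fract (A - {i}))"
        by (simp only: ac_simps)
      also have "\<dots> = alternant_fract A * ((1 - x_var i) * ((\<Prod>j\<in>A - {i}. x_var j) * ?h i))"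
        unfolding alternant_fract_remove[OF psubset.hyps i] by (simp only: ac_simps)
      also have "(\<Prod>j\<in>A - {i}. x_var j) * ?h i =
          (\<Prod>j\<in>A - {i}. x_var j * (1 - x_var i * x_var j) / (x_var j - x_var i))"
        by (simp add: prod.distrib[symmetric])
      finally show "(- 1) ^ card {j\<in>A. j < i} * ((\<Prod>j\<in>A - {i}. x_var j) * alternant_fract (A - {i})) =
          alternant_fract A * ((1 - x_var i) *
            (\<Prod>j\<in>A - {i}. x_var j * (1 - x_var i * x_var j) / (x_var j - x_var i)))" .
    qed
    also have "\<dots> = ?D * alternant_fract A"
    proof -
      have "x_var i \<noteq> - 1" for i
        using one_plus_x_var_neq_0[of i] by (metis add.right_inverse)
      then show ?thesis
        unfolding sum_distrib_left[symmetric]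
        by (subst sum_minor_weights) (auto simp: psubset.hyps x_var_inject x_var_neq_0 inj_on_def)
    qed
    finally show ?thesis
      using one_minus_prod_x_var_neq_0[OF psubset.hyps False] by simp
  qed
qed

section \<open>Growth of column heights\<close>

text \<open>Column m + u - 1 is the one that opens at step u; a box with entry u there is a maximum
  and is marked by P, which is \<open>[:0, 1:]\<close>.\<close>

definition step_weight :: "nat \<Rightarrow> nat \<Rightarrow> nat \<Rightarrow> int poly" where
  "step_weight m u c = (if c + 1 = m + u then [:0, 1:] else 1)"

definition step_factor :: "nat \<Rightarrow> nat set \<Rightarrow> nat \<Rightarrow> int poly mfps" where
  "step_factor m A u = (\<Prod>c\<in>{c\<in>A. c < m + u}. 1 + mfps_const (step_weight m u c) * mfps_X c)"

text \<open>What is left of the series when the entries up to v have been placed: each later entry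
  still contributes its factor.\<close>

definition evolved :: "nat \<Rightarrow> nat \<Rightarrow> nat set \<Rightarrow> nat \<Rightarrow> int poly mfps" where
  "evolved m n A v = (\<Prod>u\<in>{v<..n}. step_factor m A u) * alternant_series A"

text \<open>Both columns lie below m + u - 1, so neither the cutoff nor the weight P tells them
  apart.\<close>

lemma mfps_swap_step_factor:
  assumes r: "Suc r < m + v" and v: "v < u"
  shows "mfps_swap r (Suc r) (step_factor m A u) = step_factor m (transpose r (Suc r) ` A) u"
proof -
  let ?t = "transpose r (Suc r)"
  have w: "step_weight m u (?t c) = step_weight m u c" "?t c < m + u \<longleftrightarrow> c < m + u" for c
    using r v by (auto simp: step_weight_def transpose_def)
  have "mfps_swap r (Suc r) (step_factor m A u) =
      (\<Prod>c\<in>{c\<in>A. c < m + u}. 1 + mfps_const (step_weight m u c) * mfps_X (?t c))"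
    by (simp add: step_factor_def mfps_swap_prod mfps_swap_add mfps_swap_mult mfps_swap_1
        mfps_swap_const mfps_swap_X)
  also have "\<dots> = step_factor m (?t ` A) u"
    unfolding step_factor_def
    by (rule prod.reindex_bij_witness[where i = ?t and j = ?t]) (auto simp: w)
  finally show ?thesis .
qed

lemma mfps_swap_evolved_image:
  assumes "Suc r < m + v" and "\<not> (r \<in> A \<and> Suc r \<in> A)"
  shows "mfps_swap r (Suc r) (evolved m n A v) = evolved m n (transpose r (Suc r) ` A) v"
  unfolding evolved_def mfps_swap_mult mfps_swap_prod mfps_swap_alternant_series_image[OF assms(2)]
  using mfps_swap_step_factor[OF assms(1)] by simp

lemma mfps_swap_evolved:
  assumes "Suc r < m + v" and A: "finite A" "r \<in> A" "Suc r \<in> A"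
  shows "mfps_swap r (Suc r) (evolved m n A v) = - evolved m n A v"
  unfolding evolved_def mfps_swap_mult mfps_swap_prod mfps_swap_alternant_series[OF A]
  using mfps_swap_step_factor[OF assms(1)] A by (simp add: transpose_image_eq)

lemma greaterThanAtMost_insert_Suc: "v < n \<Longrightarrow> {v<..n} = insert (Suc v) {Suc v<..n}"
  by auto

lemma evolved_step: "v < n \<Longrightarrow> evolved m n A v = step_factor m A (Suc v) * evolved m n A (Suc v)"
  by (simp add: evolved_def greaterThanAtMost_insert_Suc mult.assoc)

lemma evolved_last: "evolved m n A n = alternant_series A"
  by (simp add: evolved_def)

section \<open>Eliminating variables from coefficients\<close>

definition mfps_vars :: "'a::comm_ring_1 mfps \<Rightarrow> nat set" where
  "mfps_vars f = \<Union> {Poly_Mapping.keys a | a. mfps_nth f a \<noteq> 0}"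

lemma mfps_vars_subset_iff:
  "mfps_vars f \<subseteq> D \<longleftrightarrow> (\<forall>a. mfps_nth f a \<noteq> 0 \<longrightarrow> Poly_Mapping.keys a \<subseteq> D)"
  by (auto simp: mfps_vars_def)

lemma mfps_vars_mult: "mfps_vars f \<subseteq> D \<Longrightarrow> mfps_vars g \<subseteq> D \<Longrightarrow> mfps_vars (f * g) \<subseteq> D"
  unfolding mfps_vars_subset_iff
proof (intro allI impI)
  fix k assume f: "\<forall>a. mfps_nth f a \<noteq> 0 \<longrightarrow> Poly_Mapping.keys a \<subseteq> D"
    and g: "\<forall>a. mfps_nth g a \<noteq> 0 \<longrightarrow> Poly_Mapping.keys a \<subseteq> D"
    and k: "mfps_nth (f * g) k \<noteq> 0"
  from k obtain p where "p \<in> splittings k" "mfps_nth f (fst p) * mfps_nth g (snd p) \<noteq> 0"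
    unfolding mfps_mult_nth by (metis (mono_tags, lifting) case_prod_unfold sum.neutral)
  then have "k = fst p + snd p" "mfps_nth f (fst p) \<noteq> 0" "mfps_nth g (snd p) \<noteq> 0"
    by (auto simp: splittings_def)
  then show "Poly_Mapping.keys k \<subseteq> D"
    using f g keys_add[of "fst p" "snd p"] by blast
qed

lemma mfps_vars_1: "mfps_vars 1 \<subseteq> D"
  by (auto simp: mfps_vars_subset_iff mfps_one_nth split: if_splits)

lemma mfps_vars_prod: "(\<And>i. i \<in> I \<Longrightarrow> mfps_vars (f i) \<subseteq> D) \<Longrightarrow> mfps_vars (\<Prod>i\<in>I. f i) \<subseteq> D"
  by (induction I rule: infinite_finite_induct) (simp_all add: mfps_vars_1 mfps_vars_mult)

lemma mfps_vars_linear: "c \<in> D \<Longrightarrow> mfps_vars (1 + mfps_const w * mfps_X c) \<subseteq> D"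
  by (auto simp: mfps_vars_subset_iff mfps_one_nth mfps_const_mult_nth mfps_X_def mfps_monom_nth
      split: if_splits)

lemma mfps_vars_alternant_series: "mfps_vars (alternant_series A) \<subseteq> A"
  by (auto simp: mfps_vars_subset_iff alternant_series_nth split: if_splits)

lemma mfps_vars_evolved: "mfps_vars (evolved m n A v) \<subseteq> A"
  unfolding evolved_def step_factor_def
  by (intro mfps_vars_mult mfps_vars_prod mfps_vars_linear mfps_vars_alternant_series) auto

lemma mfps_coeff_remove:
  assumes A: "finite A" "i \<in> A" and f: "mfps_vars f \<subseteq> A - {i}"
  shows "mfps_coeff A f a = (if a i = 0 then mfps_coeff (A - {i}) f a else 0)"
proof (cases "a i = 0")
  case True
  then have "expo A a = expo (A - {i}) a"
    using A by (intro poly_mapping_eqI) (auto simp: lookup_expo)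
  with True show ?thesis by (auto simp: mfps_coeff_def)
next
  case False
  have "mfps_coeff A f a = 0"
  proof (cases "0 < a i")
    case True
    then have "i \<in> Poly_Mapping.keys (expo A a)" using A by (simp add: in_keys_iff lookup_expo)
    then have "mfps_nth f (expo A a) = 0" using f unfolding mfps_vars_subset_iff by blast
    then show ?thesis by (simp add: mfps_coeff_def)
  next
    case neg: False
    then have "\<not> (\<forall>i\<in>A. 0 \<le> a i)" using False A by (auto intro!: bexI[of _ i])
    then show ?thesis unfolding mfps_coeff_def by (rule if_not_P)
  qed
  with False show ?thesis by simp
qed

lemma mfps_coeff_neg: "i \<in> A \<Longrightarrow> a i < 0 \<Longrightarrow> mfps_coeff A f a = 0"
  unfolding mfps_coeff_def by (rule if_not_P) (auto simp: not_le)

lemma mfps_coeff_0: "mfps_coeff A 0 a = 0"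
  and mfps_coeff_add: "mfps_coeff A (f + g) a = mfps_coeff A f a + mfps_coeff A g a"
  by (simp_all add: mfps_coeff_def)

lemma mfps_coeff_sum: "mfps_coeff A (\<Sum>i\<in>I. f i) a = (\<Sum>i\<in>I. mfps_coeff A (f i) a)"
  by (induction I rule: infinite_finite_induct) (simp_all add: mfps_coeff_0 mfps_coeff_add)

lemma mfps_coeff_sign: "mfps_coeff A ((- 1) ^ e * f) a = (- 1) ^ e * mfps_coeff A f a"
  by (cases "even e") (simp_all add: mfps_coeff_def)

lemma mfps_coeff_alternant_series:
  assumes A: "finite A" and nonneg: "\<And>i. i \<in> A \<Longrightarrow> 0 \<le> a i"
    and mono: "\<And>i j. i \<in> A \<Longrightarrow> j \<in> A \<Longrightarrow> i < j \<Longrightarrow> a i < a j"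
  shows "mfps_coeff A (alternant_series A) a = 1"
proof -
  have "alternant_coeff A (Poly_Mapping.lookup (expo A a)) = 1"
  proof (rule alternant_coeff_strict_mono)
    fix i j assume ij: "i \<in> A" "j \<in> A" "i < j"
    show "Poly_Mapping.lookup (expo A a) i < Poly_Mapping.lookup (expo A a) j"
      using ij mono[OF ij] nonneg[OF ij(1)] A by (simp add: lookup_expo)
  qed
  then show ?thesis
    using nonneg keys_expo_subset[OF A] by (simp add: mfps_coeff_def alternant_series_nth)
qed

text \<open>
  Column heights of semistandard tableaux: \<open>h c\<close> is the height of column \<open>c\<close>, and the entries
  \<open>\<le> u\<close> of a tableau occupy the columns \<open>c < m + u\<close> only.
\<close>

definition config :: "nat \<Rightarrow> nat \<Rightarrow> nat \<Rightarrow> (nat \<Rightarrow> nat) \<Rightarrow> bool" where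
  "config m N u h \<longleftrightarrow> (\<forall>c. c \<notin> {1..N} \<or> m + u \<le> c \<longrightarrow> h c = 0) \<and>
    (\<forall>c. 1 \<le> c \<and> c < N \<longrightarrow> h (Suc c) \<le> h c)"

definition grow :: "(nat \<Rightarrow> nat) \<Rightarrow> nat set \<Rightarrow> nat \<Rightarrow> nat" where
  "grow h B c = h c + of_bool (c \<in> B)"

text \<open>At height 0 this is the negative of the exponent of x_c in the constant term. For column
  1 it is k - 1 - h, hence nonnegative exactly below height k; for column 2 it is k - h.\<close>

definition config_expo :: "nat \<Rightarrow> (nat \<Rightarrow> nat) \<Rightarrow> nat \<Rightarrow> int" where
  "config_expo k h c = int c + int k - 2 - int (h c)"

lemma config_antimono:
  assumes "config m N u h" "1 \<le> c" "c \<le> d" "d \<le> N"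
  shows "h d \<le> h c"
  using assms(3,4)
proof (induction d rule: dec_induct)
  case (step d)
  then have "h (Suc d) \<le> h d" using assms(1,2) by (simp add: config_def)
  with step show ?case by simp
qed simp

lemma config_expo_strict_mono:
  assumes "config m N u h" "1 \<le> c" "c < d" "d \<le> N"
  shows "config_expo k h c < config_expo k h d"
  using config_antimono[OF assms(1,2) less_imp_le[OF assms(3)] assms(4)] assms(3)
  by (simp add: config_expo_def)

lemma mfps_coeff_step_factor:
  assumes "finite A"
  shows "mfps_coeff A (step_factor m A u * f) (config_expo k h) =
    (\<Sum>B\<in>Pow {c\<in>A. c < m + u}. (\<Prod>c\<in>B. step_weight m u c) * mfps_coeff A f (config_expo k (grow h B)))"
proof -
  have eq: "(\<lambda>i. config_expo k h i - of_bool (i \<in> B)) = config_expo k (grow h B)" for B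
    by (auto simp: config_expo_def grow_def)
  have "{c\<in>A. c < m + u} \<subseteq> A" by blast
  from mfps_coeff_prod_linear[OF assms this, of "step_weight m u" f "config_expo k h"]
  show ?thesis unfolding step_factor_def eq .
qed

text \<open>
  A choice \<open>B\<close> of growing columns that breaks the column order produces two equal exponents
  among variables in which the series is antisymmetric.
\<close>

lemma mfps_coeff_grow_eq_0:
  assumes h: "config m N v h" and l: "1 \<le> l" and B: "B \<subseteq> {c\<in>{l..N}. c < m + u}"
    and anti: "\<And>r. l \<le> r \<Longrightarrow> Suc r \<le> N \<Longrightarrow> Suc r < m + u \<Longrightarrow> mfps_swap r (Suc r) f = - f"
    and c: "l \<le> c" "c < N" "grow h B c < grow h B (Suc c)"
  shows "mfps_coeff {l..N} (f :: int poly mfps) (config_expo k (grow h B)) = 0"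
proof -
  have "h (Suc c) \<le> h c" using h l c by (simp add: config_def)
  \<comment> \<open>The heights were ordered before and change by at most 1, so the order breaks
    only from a tie, with the right column growing and the left one not.\<close>
  with c(3) have *: "h (Suc c) = h c" "c \<notin> B" "Suc c \<in> B"
    by (cases "c \<in> B"; cases "Suc c \<in> B"; simp add: grow_def)+
  then have "config_expo k (grow h B) c = config_expo k (grow h B) (Suc c)"
    by (simp add: config_expo_def grow_def)
  \<comment> \<open>\<open>Suc c \<in> B\<close> says that column \<open>Suc c\<close> is open,
    which is the condition for antisymmetry.\<close>
  moreover have "mfps_swap c (Suc c) f = - f" using * B c by (intro anti) auto
  ultimately show ?thesis
    using c by (intro mfps_coeff_antisymmetric_eq_0[of _ c "Suc c"]) auto
qed

text \<open>Histories of the heights through the steps 0 to v; the value 0 beyond v makes equal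
  histories equal functions. \<open>C\<close> leaves room for a condition on the first
  column.\<close>

definition trajectories ::
    "nat \<Rightarrow> nat \<Rightarrow> (nat \<Rightarrow> (nat \<Rightarrow> nat) \<Rightarrow> bool) \<Rightarrow> nat \<Rightarrow> (nat \<Rightarrow> nat \<Rightarrow> nat) set" where
  "trajectories m N C v = {h. (\<forall>u c. v < u \<longrightarrow> h u c = 0) \<and> (\<forall>c. h 0 c = 0) \<and>
     (\<forall>u<v. \<forall>c. h (Suc u) c = h u c \<or> h (Suc u) c = Suc (h u c)) \<and>
     (\<forall>u\<le>v. config m N u (h u) \<and> C u (h u))}"

text \<open>Column m + u - 1 is empty before step u, so positive height means that entry u was put
  there. For m = 0 and u = 1 this is column 0, always empty; that maximum is accounted for
  separately.\<close>

definition trajectory_maxima :: "nat \<Rightarrow> nat \<Rightarrow> (nat \<Rightarrow> nat \<Rightarrow> nat) \<Rightarrow> nat set" where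
  "trajectory_maxima m v h = {u. 1 \<le> u \<and> u \<le> v \<and> 0 < h u (m + u - 1)}"

lemma finite_trajectory_maxima [simp]: "finite (trajectory_maxima m v h)"
  by (rule finite_subset[of _ "{..v}"]) (auto simp: trajectory_maxima_def)

definition admissible_growths ::
    "nat \<Rightarrow> nat \<Rightarrow> (nat \<Rightarrow> (nat \<Rightarrow> nat) \<Rightarrow> bool) \<Rightarrow> nat \<Rightarrow> (nat \<Rightarrow> nat) \<Rightarrow> nat set set" where
  "admissible_growths m N C v h = {B. B \<subseteq> {c\<in>{1..N}. c < m + Suc v} \<and>
     config m N (Suc v) (grow h B) \<and> C (Suc v) (grow h B)}"

lemma finite_admissible_growths [simp]: "finite (admissible_growths m N C v h)"
  by (rule finite_subset[of _ "Pow {1..N}"]) (auto simp: admissible_growths_def)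

lemma trajectories_extend:
  assumes h: "h \<in> trajectories m N C v" and B: "B \<in> admissible_growths m N C v (h v)"
  shows "h(Suc v := grow (h v) B) \<in> trajectories m N C (Suc v)"
  using h B unfolding trajectories_def admissible_growths_def
  by (auto simp: le_Suc_eq less_Suc_eq grow_def)

lemma trajectories_restrict:
  assumes h: "h \<in> trajectories m N C (Suc v)"
  defines "B \<equiv> {c. h (Suc v) c \<noteq> h v c}"
  shows "h(Suc v := \<lambda>_. 0) \<in> trajectories m N C v" "h (Suc v) = grow (h v) B"
    "B \<in> admissible_growths m N C v (h v)"
proof -
  show "h(Suc v := \<lambda>_. 0) \<in> trajectories m N C v"
    using h by (auto simp: trajectories_def)
  have step: "h (Suc v) c = h v c \<or> h (Suc v) c = Suc (h v c)" for c
    using h by (auto simp: trajectories_def)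
  then show eq: "h (Suc v) = grow (h v) B"
    by (fastforce simp: grow_def B_def)
  have c: "config m N (Suc v) (h (Suc v))" "C (Suc v) (h (Suc v))"
    using h by (auto simp: trajectories_def)
  have "B \<subseteq> {c\<in>{1..N}. c < m + Suc v}"
  proof
    fix c assume "c \<in> B"
    then have "h (Suc v) c \<noteq> 0" using step[of c] by (auto simp: B_def)
    then show "c \<in> {c\<in>{1..N}. c < m + Suc v}" using c(1) unfolding config_def by (metis (mono_tags, lifting) mem_Collect_eq not_le)
  qed
  with c eq show "B \<in> admissible_growths m N C v (h v)" by (simp add: admissible_growths_def)
qed

lemma finite_trajectories [simp]: "finite (trajectories m N C v)"
proof (induction v)
  case 0
  have "h = (\<lambda>_ _. 0)" if "h \<in> trajectories m N C 0" for h
  proof (intro ext)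
    fix u c show "h u c = 0" using that by (cases "u = 0") (auto simp: trajectories_def)
  qed
  then have "trajectories m N C 0 \<subseteq> {\<lambda>_ _. 0}" by blast
  then show ?case by (rule finite_subset) simp
next
  case (Suc v)
  have "trajectories m N C (Suc v) \<subseteq>
      (\<lambda>(h, B). h(Suc v := grow (h v) B)) ` (trajectories m N C v \<times> Pow {1..N})"
  proof
    fix h assume h: "h \<in> trajectories m N C (Suc v)"
    let ?B = "{c. h (Suc v) c \<noteq> h v c}" and ?h = "h(Suc v := \<lambda>_. 0)"
    note r = trajectories_restrict[OF h]
    have "h = (\<lambda>(h, B). h(Suc v := grow (h v) B)) (?h, ?B)" using r(2) by auto
    moreover have "?B \<in> Pow {1..N}" using r(3) by (auto simp: admissible_growths_def)
    ultimately show "h \<in> (\<lambda>(h, B). h(Suc v := grow (h v) B)) ` (trajectories m N C v \<times> Pow {1..N})"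
      using r(1) by blast
  qed
  then show ?case using Suc finite_subset by fast
qed

lemma trajectory_maxima_extend:
  assumes h: "h \<in> trajectories m N C v" and B: "B \<in> admissible_growths m N C v (h v)"
  shows "monom 1 (card (trajectory_maxima m (Suc v) (h(Suc v := grow (h v) B)))) =
    monom 1 (card (trajectory_maxima m v h)) * (\<Prod>c\<in>B. step_weight m (Suc v) c)"
proof -
  have "B \<subseteq> {1..N}" using B by (auto simp: admissible_growths_def)
  then have fB: "finite B" using finite_subset by blast
  have "config m N v (h v)" using h by (simp add: trajectories_def)
  \<comment> \<open>Column m + v is still closed, so after the step its height is positive exactly
    if it lies in \<open>B\<close>.\<close>
  then have h0: "h v (m + v) = 0" by (simp add: config_def)
  let ?h = "h(Suc v := grow (h v) B)"
  have "(\<Prod>c\<in>B. step_weight m (Suc v) c) = (\<Prod>c\<in>B. if m + v = c then [:0, 1:] else 1)"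
    by (intro prod.cong) (auto simp: step_weight_def)
  also have "\<dots> = (if m + v \<in> B then [:0, 1:] else 1)" using fB by simp
  finally have w: "(\<Prod>c\<in>B. step_weight m (Suc v) c) = (if m + v \<in> B then [:0, 1:] else 1)" .
  show ?thesis
  proof (cases "m + v \<in> B")
    case True
    then have "trajectory_maxima m (Suc v) ?h = insert (Suc v) (trajectory_maxima m v h)"
      by (auto simp: trajectory_maxima_def grow_def le_Suc_eq)
    moreover have "Suc v \<notin> trajectory_maxima m v h" by (simp add: trajectory_maxima_def)
    ultimately show ?thesis using True unfolding w
      by (simp add: monom_Suc mult.commute)
  next
    case False
    then have "trajectory_maxima m (Suc v) ?h = trajectory_maxima m v h"
      using h0 by (auto simp: trajectory_maxima_def grow_def le_Suc_eq)
    then show ?thesis using False unfolding w by simp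
  qed
qed

lemma sum_trajectories_Suc:
  "(\<Sum>h\<in>trajectories m N C (Suc v). monom 1 (card (trajectory_maxima m (Suc v) h)) * \<phi> (h (Suc v))) =
    (\<Sum>h\<in>trajectories m N C v. monom 1 (card (trajectory_maxima m v h)) *
      (\<Sum>B\<in>admissible_growths m N C v (h v). (\<Prod>c\<in>B. step_weight m (Suc v) c) * \<phi> (grow (h v) B)))"
  (is "?L = ?R")
proof -
  let ?T = "SIGMA h:trajectories m N C v. admissible_growths m N C v (h v)"
  have "?R = (\<Sum>(h, B)\<in>?T. monom 1 (card (trajectory_maxima m v h)) *
      ((\<Prod>c\<in>B. step_weight m (Suc v) c) * \<phi> (grow (h v) B)))"
    by (simp add: sum_distrib_left sum.Sigma)
  also have "\<dots> = (\<Sum>(h, B)\<in>?T. monom 1 (card (trajectory_maxima m (Suc v) (h(Suc v := grow (h v) B)))) *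
      \<phi> (grow (h v) B))"
    by (intro sum.cong refl) (auto simp: trajectory_maxima_extend mult.assoc simp del: fun_upd_apply)
  also have "\<dots> = ?L"
  proof (rule sum.reindex_bij_witness[where j = "\<lambda>(h, B). h(Suc v := grow (h v) B)"
        and i = "\<lambda>h. (h(Suc v := \<lambda>_. 0), {c. h (Suc v) c \<noteq> h v c})"], goal_cases)
    case (1 p)
    then obtain h B where p: "p = (h, B)" "h \<in> trajectories m N C v" by auto
    then have "h(Suc v := \<lambda>_. 0) = h" by (intro ext) (auto simp: trajectories_def)
    then show ?case using p by (auto simp: grow_def)
  next
    case (2 p)
    then show ?case using trajectories_extend by auto
  next
    case (3 h)
    then show ?case using trajectories_restrict(2)[OF 3] by auto
  next
    case (4 h)
    then show ?case using trajectories_restrict[OF 4] by auto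
  next
    case (5 p)
    then show ?case by auto
  qed
  finally show ?thesis by simp
qed

text \<open>\<open>\<phi> v h\<close> acts as the weighted number of completions of a history with
  heights h at time v. The step hypothesis is the recursion for it, so the weighted sum over
  histories up to v is independent of v.\<close>

lemma sum_trajectories_transfer:
  assumes step: "\<And>v h. v < n \<Longrightarrow> config m N v h \<Longrightarrow> C v h \<Longrightarrow>
      (\<Sum>B\<in>admissible_growths m N C v h. (\<Prod>c\<in>B. step_weight m (Suc v) c) * \<phi> (Suc v) (grow h B)) = \<phi> v h"
    and last: "\<And>h. config m N n h \<Longrightarrow> C n h \<Longrightarrow> \<phi> n h = 1"
    and first: "C 0 (\<lambda>_. 0)"
  shows "(\<Sum>h\<in>trajectories m N C n. monom 1 (card (trajectory_maxima m n h))) = \<phi> 0 (\<lambda>_. 0)"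
proof -
  let ?s = "\<lambda>v. \<Sum>h\<in>trajectories m N C v. monom 1 (card (trajectory_maxima m v h)) * \<phi> v (h v)"
  have "?s v = \<phi> 0 (\<lambda>_. 0)" if "v \<le> n" for v
    using that
  proof (induction v)
    case 0
    have "trajectories m N C 0 = {\<lambda>_ _. 0}"
    proof (intro set_eqI iffI)
      fix h assume h: "h \<in> trajectories m N C 0"
      have "h u c = 0" for u c using h by (cases "u = 0") (auto simp: trajectories_def)
      then show "h \<in> {\<lambda>_ _. 0}" by auto
    qed (use first in \<open>auto simp: trajectories_def config_def\<close>)
    moreover have "trajectory_maxima m 0 h = {}" for h by (auto simp: trajectory_maxima_def)
    ultimately show ?case by (simp add: one_pCons monom_0)
  next
    case (Suc v)
    have "?s (Suc v) = ?s v"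
      unfolding sum_trajectories_Suc
    proof (intro sum.cong refl arg_cong2[of _ _ _ _ "(*)"])
      fix h assume "h \<in> trajectories m N C v"
      then have "config m N v (h v)" "C v (h v)" by (auto simp: trajectories_def)
      then show "(\<Sum>B\<in>admissible_growths m N C v (h v). (\<Prod>c\<in>B. step_weight m (Suc v) c) * \<phi> (Suc v) (grow (h v) B)) = \<phi> v (h v)"
        using Suc.prems by (intro step) auto
    qed
    then show ?case using Suc by simp
  qed
  then have "?s n = \<phi> 0 (\<lambda>_. 0)" by simp
  moreover have "\<phi> n (h n) = 1" if "h \<in> trajectories m N C n" for h
    using that by (intro last) (auto simp: trajectories_def)
  ultimately show ?thesis by simp
qed

text \<open>The first column reaches height k at time k + q exactly; for k + q = n + 1 it never
  does.\<close>

definition minima_constraint :: "nat \<Rightarrow> nat \<Rightarrow> nat \<Rightarrow> (nat \<Rightarrow> nat) \<Rightarrow> bool" where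
  "minima_constraint k q u h \<longleftrightarrow> (if u < k + q then h 1 < k else h 1 = k)"

text \<open>For w = n column 1 stays below k to the end and nothing is deleted. Otherwise one
  variable is deleted, and only the term of x_1 matters; the alternating sum over all open columns
  serves to restore antisymmetry.\<close>

definition top_series :: "nat \<Rightarrow> nat \<Rightarrow> nat \<Rightarrow> nat \<Rightarrow> int poly mfps" where
  "top_series m n N w = (if w = n then alternant_series {1..N}
     else \<Sum>i\<in>{i\<in>{1..N}. i < m + w}. (- 1) ^ (i - 1) * evolved m n ({1..N} - {i}) w)"

text \<open>Used with w = k + q - 1, the last time at which column 1 is below k: up to w all
  variables evolve, at w one is deleted.\<close>

definition series_at :: "nat \<Rightarrow> nat \<Rightarrow> nat \<Rightarrow> nat \<Rightarrow> nat \<Rightarrow> int poly mfps" where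
  "series_at m n N w v = (\<Prod>u\<in>{v<..w}. step_factor m {1..N} u) * top_series m n N w"

lemma mfps_swap_sign: "mfps_swap r s ((- 1) ^ e * f) = (- 1) ^ e * mfps_swap r s f"
  by (cases "even e") (simp_all add: mfps_swap_uminus)

text \<open>The summands for r and \<open>Suc r\<close> change places, and their signs in the
  alternating sum differ. Any other summand contains both variables and is antisymmetric
  itself.\<close>

lemma mfps_swap_top_series:
  assumes r: "1 \<le> r" "Suc r \<le> N" "Suc r < m + w"
  shows "mfps_swap r (Suc r) (top_series m n N w) = - top_series m n N w"
proof (cases "w = n")
  case True
  then show ?thesis using r by (simp add: top_series_def mfps_swap_alternant_series)
next
  case False
  let ?A = "{1..N}" and ?t = "transpose r (Suc r)"
  let ?I = "{i\<in>?A. i < m + w}"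
  have img: "?t ` (?A - {i}) = ?A - {?t i}" for i
    using r by (simp add: image_set_diff transpose_image_eq)
  have mem: "?t i \<in> ?I" if "i \<in> ?I" for i
    using that r by (auto simp: transpose_def)
  have swap_summand: "(- 1) ^ (i - 1) * mfps_swap r (Suc r) (evolved m n (?A - {i}) w) =
      - ((- 1) ^ (?t i - 1) * evolved m n (?A - {?t i}) w)" if i: "i \<in> ?I" for i
  proof (cases "i = r \<or> i = Suc r")
    case True
    then have "mfps_swap r (Suc r) (evolved m n (?A - {i}) w) = evolved m n (?t ` (?A - {i})) w"
      using r by (intro mfps_swap_evolved_image) auto
    then have "mfps_swap r (Suc r) (evolved m n (?A - {i}) w) = evolved m n (?A - {?t i}) w"
      by (simp only: img)
    moreover have "(- 1 :: int poly mfps) ^ (i - 1) = - ((- 1) ^ (?t i - 1))"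
      using True r by (cases r) auto
    ultimately show ?thesis by simp
  next
    case F: False
    then have "mfps_swap r (Suc r) (evolved m n (?A - {i}) w) = - evolved m n (?A - {i}) w"
      using r by (subst mfps_swap_evolved) auto
    then show ?thesis using F by simp
  qed
  have "mfps_swap r (Suc r) (top_series m n N w) =
      (\<Sum>i\<in>?I. - ((- 1) ^ (?t i - 1) * evolved m n (?A - {?t i}) w))"
    using False unfolding top_series_def
    by (simp only: if_False mfps_swap_sum mfps_swap_sign swap_summand cong: sum.cong)
  also have "\<dots> = - (\<Sum>i\<in>?I. (- 1) ^ (?t i - 1) * evolved m n (?A - {?t i}) w)"
    by (rule sum_negf)
  also have "(\<Sum>i\<in>?I. (- 1) ^ (?t i - 1) * evolved m n (?A - {?t i}) w) =
      (\<Sum>i\<in>?I. (- 1) ^ (i - 1) * evolved m n (?A - {i}) w)"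
    using mem by (intro sum.reindex_bij_witness[where i = ?t and j = ?t]) simp_all
  finally show ?thesis using False by (simp add: top_series_def)
qed

lemma mfps_swap_series_at:
  assumes r: "1 \<le> r" "Suc r \<le> N" "Suc r < m + v" and v: "v \<le> w"
  shows "mfps_swap r (Suc r) (series_at m n N w v) = - series_at m n N w v"
proof -
  have "transpose r (Suc r) ` {1..N} = {1..N}" using r by (simp add: transpose_image_eq)
  moreover have "Suc r < m + w" using r v by simp
  ultimately show ?thesis
    unfolding series_at_def mfps_swap_mult mfps_swap_prod
    using mfps_swap_step_factor[OF r(3)] mfps_swap_top_series[OF r(1,2)] by simp
qed

lemma series_at_step:
  "v < w \<Longrightarrow> series_at m n N w v = step_factor m {1..N} (Suc v) * series_at m n N w (Suc v)"
  by (simp add: series_at_def greaterThanAtMost_insert_Suc mult.assoc)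

text \<open>Common core of the three transfers below: a growth outside \<open>T\<close> contributes
  0 either by a tie between antisymmetric variables or by a negative exponent.\<close>

lemma mfps_coeff_step_restrict:
  assumes h: "config m N v h" and l: "1 \<le> l"
    and anti: "\<And>r. l \<le> r \<Longrightarrow> Suc r \<le> N \<Longrightarrow> Suc r < m + Suc v \<Longrightarrow> mfps_swap r (Suc r) f = - f"
    and T: "T \<subseteq> Pow {c\<in>{l..N}. c < m + Suc v}"
    and nT: "\<And>B. B \<subseteq> {c\<in>{l..N}. c < m + Suc v} \<Longrightarrow> B \<notin> T \<Longrightarrow>
      (\<exists>c. l \<le> c \<and> c < N \<and> grow h B c < grow h B (Suc c)) \<or>
      (\<exists>i\<in>{l..N}. config_expo k (grow h B) i < 0)"
  shows "mfps_coeff {l..N} (step_factor m {l..N} (Suc v) * f) (config_expo k h) =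
    (\<Sum>B\<in>T. (\<Prod>c\<in>B. step_weight m (Suc v) c) * mfps_coeff {l..N} f (config_expo k (grow h B)))"
  unfolding mfps_coeff_step_factor[OF finite_atLeastAtMost]
proof (rule sum.mono_neutral_right)
  show "\<forall>B\<in>Pow {c\<in>{l..N}. c < m + Suc v} - T.
      (\<Prod>c\<in>B. step_weight m (Suc v) c) * mfps_coeff {l..N} f (config_expo k (grow h B)) = 0"
  proof
    fix B assume "B \<in> Pow {c\<in>{l..N}. c < m + Suc v} - T"
    then have B: "B \<subseteq> {c\<in>{l..N}. c < m + Suc v}" "B \<notin> T" by auto
    from nT[OF B] have "mfps_coeff {l..N} f (config_expo k (grow h B)) = 0"
    proof (elim disjE exE conjE bexE)
      fix c assume "l \<le> c" "c < N" "grow h B c < grow h B (Suc c)"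
      then show ?thesis using mfps_coeff_grow_eq_0[OF h l B(1) anti] by blast
    next
      fix i assume "i \<in> {l..N}" "config_expo k (grow h B) i < 0"
      then show ?thesis by (rule mfps_coeff_neg)
    qed
    then show "(\<Prod>c\<in>B. step_weight m (Suc v) c) * mfps_coeff {l..N} f (config_expo k (grow h B)) = 0"
      by simp
  qed
qed (use T in auto)

lemma config_eq_0: "config m N u h \<Longrightarrow> c \<notin> {1..N} \<Longrightarrow> h c = 0"
  by (simp add: config_def)

lemma config_grow_iff:
  assumes "config m N v h" "B \<subseteq> {c\<in>{1..N}. c < m + Suc v}"
  shows "config m N (Suc v) (grow h B) \<longleftrightarrow>
    (\<forall>c. 1 \<le> c \<and> c < N \<longrightarrow> grow h B (Suc c) \<le> grow h B c)"
proof -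
  have "grow h B c = 0" if "c \<notin> {1..N} \<or> m + Suc v \<le> c" for c
  proof -
    have "h c = 0" "c \<notin> B" using that assms by (auto simp: config_def)
    then show ?thesis by (simp add: grow_def)
  qed
  then show ?thesis by (simp add: config_def)
qed

text \<open>An ordered growth is forbidden only if column 1 reaches k, and then the exponent of x_1
  is negative.\<close>

lemma transfer_before:
  assumes h: "config m N v h" and k: "1 \<le> k" and v: "Suc v < k + q"
  shows "(\<Sum>B\<in>admissible_growths m N (minima_constraint k q) v h. (\<Prod>c\<in>B. step_weight m (Suc v) c) *
      mfps_coeff {1..N} (series_at m n N (k + q - 1) (Suc v)) (config_expo k (grow h B))) =
    mfps_coeff {1..N} (series_at m n N (k + q - 1) v) (config_expo k h)"
proof -
  let ?f = "series_at m n N (k + q - 1) (Suc v)"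
  have "mfps_coeff {1..N} (step_factor m {1..N} (Suc v) * ?f) (config_expo k h) =
    (\<Sum>B\<in>admissible_growths m N (minima_constraint k q) v h. (\<Prod>c\<in>B. step_weight m (Suc v) c) *
      mfps_coeff {1..N} ?f (config_expo k (grow h B)))"
  proof (rule mfps_coeff_step_restrict[OF h])
    fix B assume B: "B \<subseteq> {c\<in>{1..N}. c < m + Suc v}"
      and nB: "B \<notin> admissible_growths m N (minima_constraint k q) v h"
    show "(\<exists>c. 1 \<le> c \<and> c < N \<and> grow h B c < grow h B (Suc c)) \<or>
      (\<exists>i\<in>{1..N}. config_expo k (grow h B) i < 0)"
    proof (cases "config m N (Suc v) (grow h B)")
      case False
      then show ?thesis unfolding config_grow_iff[OF h B] by (auto simp: not_le)
    next
      case True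
      then have ge: "k \<le> grow h B 1"
        using nB B v by (simp add: admissible_growths_def minima_constraint_def)
      with k have "grow h B 1 \<noteq> 0" by simp
      then have "1 \<in> {1..N}" using config_eq_0[OF True] by metis
      moreover have "config_expo k (grow h B) 1 < 0" using ge by (simp add: config_expo_def)
      ultimately show ?thesis by blast
    qed
  qed (use v in \<open>auto simp: admissible_growths_def intro!: mfps_swap_series_at\<close>)
  then show ?thesis using series_at_step[of v "k + q - 1" m n N] v by simp
qed

text \<open>Column 1 is fixed at k and its variable is gone, so antisymmetry cannot guard the order
  between columns 1 and 2; the sign of the exponent of x_2 does.\<close>

lemma transfer_after:
  assumes h: "config m N v h" and C: "h 1 = k" and v: "k + q \<le> v" "v < n"
  shows "(\<Sum>B\<in>admissible_growths m N (minima_constraint k q) v h. (\<Prod>c\<in>B. step_weight m (Suc v) c) *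
      mfps_coeff {2..N} (evolved m n {2..N} (Suc v)) (config_expo k (grow h B))) =
    mfps_coeff {2..N} (evolved m n {2..N} v) (config_expo k h)"
  unfolding evolved_step[OF v(2)]
proof (rule mfps_coeff_step_restrict[OF h, symmetric])
  show "admissible_growths m N (minima_constraint k q) v h \<subseteq> Pow {c\<in>{2..N}. c < m + Suc v}"
  proof
    fix B assume "B \<in> admissible_growths m N (minima_constraint k q) v h"
    then have B: "B \<subseteq> {c\<in>{1..N}. c < m + Suc v}" and "grow h B 1 = k"
      using v by (auto simp: admissible_growths_def minima_constraint_def)
    then have "1 \<notin> B" using C by (auto simp: grow_def)
    have "c \<in> {c\<in>{2..N}. c < m + Suc v}" if "c \<in> B" for c
    proof -
      have "c \<noteq> 1" using that \<open>1 \<notin> B\<close> by blast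
      then show ?thesis using that B by fastforce
    qed
    then show "B \<in> Pow {c\<in>{2..N}. c < m + Suc v}" by blast
  qed
  fix B assume B: "B \<subseteq> {c\<in>{2..N}. c < m + Suc v}"
    and nB: "B \<notin> admissible_growths m N (minima_constraint k q) v h"
  have B1: "B \<subseteq> {c\<in>{1..N}. c < m + Suc v}" using B by fastforce
  have g1: "grow h B 1 = k" using B C by (auto simp: grow_def)
  then have "\<not> config m N (Suc v) (grow h B)"
    using nB B1 v by (simp add: admissible_growths_def minima_constraint_def)
  then obtain c where c: "1 \<le> c" "c < N" "grow h B c < grow h B (Suc c)"
    unfolding config_grow_iff[OF h B1] by (auto simp: not_le)
  show "(\<exists>c. 2 \<le> c \<and> c < N \<and> grow h B c < grow h B (Suc c)) \<or>
      (\<exists>i\<in>{2..N}. config_expo k (grow h B) i < 0)"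
  proof (cases "c = 1")
    \<comment> \<open>Column 2 would exceed height k, so its exponent k - h is negative.\<close>
    case True
    then have "config_expo k (grow h B) 2 < 0" using c(3) g1
      by (simp add: config_expo_def numeral_2_eq_2)
    moreover have "2 \<in> {2..N}" using True c by simp
    ultimately show ?thesis by blast
  next
    case False
    then have "2 \<le> c" using c(1) by simp
    then show ?thesis using c by blast
  qed
qed (auto intro!: mfps_swap_evolved)

text \<open>A deleted variable must have exponent 0. Exponents increase strictly, so for i > 1 this
  makes the exponent of x_1 negative, and only i = 1 survives, with column 1 at height k -
  1.\<close>

lemma mfps_coeff_top_series:
  assumes h: "config m N w h" and k: "h 1 < k" and w: "w \<noteq> n"
  shows "mfps_coeff {1..N} (top_series m n N w) (config_expo k h) =
    (if 1 \<le> N \<and> 1 < m + w \<and> Suc (h 1) = k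
     then mfps_coeff {2..N} (evolved m n {2..N} w) (config_expo k h) else 0)"
proof -
  let ?a = "config_expo k h"
  let ?F = "\<lambda>i. (- 1) ^ (i - 1) *
    (if ?a i = 0 then mfps_coeff ({1..N} - {i}) (evolved m n ({1..N} - {i}) w) ?a else 0)"
  have "mfps_coeff {1..N} (top_series m n N w) ?a = (\<Sum>i\<in>{i\<in>{1..N}. i < m + w}. ?F i)"
    unfolding top_series_def if_not_P[OF w] mfps_coeff_sum mfps_coeff_sign
    by (intro sum.cong refl arg_cong2[of _ _ _ _ "(*)"] mfps_coeff_remove mfps_vars_evolved) auto
  also have "\<dots> = (\<Sum>i\<in>{i\<in>{1..N}. i < m + w}. if i = 1 then ?F 1 else 0)"
  proof (intro sum.cong refl)
    fix i assume i: "i \<in> {i\<in>{1..N}. i < m + w}"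
    show "?F i = (if i = 1 then ?F 1 else 0)"
    proof (cases "i = 1")
      case False
      have "?a 1 < 0" if "?a i = 0"
        using config_expo_strict_mono[OF h, of 1 i k] i False that by simp
      moreover have "1 \<in> {1..N} - {i}" using i False by simp
      ultimately have "mfps_coeff ({1..N} - {i}) f ?a = 0" if "?a i = 0" for f :: "int poly mfps"
        using that by (intro mfps_coeff_neg)
      then have "?F i = 0" by simp
      then show ?thesis using False by simp
    qed simp
  qed
  also have "\<dots> = (if 1 \<le> N \<and> 1 < m + w then ?F 1 else 0)"
    by (subst sum.delta) auto
  also have "?a 1 = 0 \<longleftrightarrow> Suc (h 1) = k" by (auto simp: config_expo_def)
  also have "{1..N} - {1} = {2..N}" by auto
  finally show ?thesis by simp
qed

text \<open>Column 1 receives its box number k in this step. Its growth is forced, so only the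
  choices for the columns from 2 on remain, as in the series without x_1.\<close>

lemma transfer_at:
  assumes h: "config m N v h" and C: "h 1 < k" and v: "Suc v = k + q" "v < n"
    and excl: "k \<noteq> 1 \<or> m + q \<noteq> 1"
  shows "(\<Sum>B\<in>admissible_growths m N (minima_constraint k q) v h. (\<Prod>c\<in>B. step_weight m (Suc v) c) *
      mfps_coeff {2..N} (evolved m n {2..N} (Suc v)) (config_expo k (grow h B))) =
    mfps_coeff {1..N} (top_series m n N v) (config_expo k h)"
proof -
  let ?adm = "admissible_growths m N (minima_constraint k q) v h"
  have adm: "1 \<in> B \<and> Suc (h 1) = k" if "B \<in> ?adm" for B
  proof -
    have "grow h B 1 = k" using that v by (simp add: admissible_growths_def minima_constraint_def)
    then show ?thesis using C by (cases "1 \<in> B") (auto simp: grow_def)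
  qed
  show ?thesis
  proof (cases "1 \<le> N \<and> 1 < m + v \<and> Suc (h 1) = k")
    case False
    have "?adm = {}"
    proof (rule ccontr)
      assume "?adm \<noteq> {}"
      then obtain B where B: "B \<in> ?adm" by blast
      then have 1: "1 \<in> B" "Suc (h 1) = k" using adm by auto
      then have "1 \<le> N" "1 < m + Suc v" using B by (auto simp: admissible_growths_def)
      moreover have "\<not> 1 < m + v" using False 1 \<open>1 \<le> N\<close> by blast
      \<comment> \<open>Column 1 opens in this very step and was empty before, so its first box is
        already number k. This is the excluded case.\<close>
      ultimately have "m + v = 1" by linarith
      then have "h 1 = 0" using h by (simp add: config_def)
      with 1 \<open>m + v = 1\<close> v have "k = 1" "m + q = 1" by auto
      with excl show False by simp
    qed
    then show ?thesis
      using False by (simp only: mfps_coeff_top_series[OF h C less_imp_neq[OF v(2)]] if_False sum.empty)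
  next
    case True
    let ?T = "{B. B \<subseteq> {c\<in>{2..N}. c < m + Suc v} \<and> insert 1 B \<in> ?adm}"
    have coeff_insert: "mfps_coeff {2..N} f (config_expo k (grow h (insert 1 B))) =
        mfps_coeff {2..N} f (config_expo k (grow h B))" for f :: "int poly mfps" and B
      by (rule mfps_coeff_cong) (simp add: config_expo_def grow_def)
    have "(\<Sum>B\<in>?adm. (\<Prod>c\<in>B. step_weight m (Suc v) c) *
        mfps_coeff {2..N} (evolved m n {2..N} (Suc v)) (config_expo k (grow h B))) =
      (\<Sum>B\<in>?T. (\<Prod>c\<in>B. step_weight m (Suc v) c) *
        mfps_coeff {2..N} (evolved m n {2..N} (Suc v)) (config_expo k (grow h B)))"
    proof (rule sum.reindex_bij_witness[where i = "insert 1" and j = "\<lambda>B. B - {1}"], goal_cases)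
      case (1 B)
      then show ?case using adm by blast
    next
      case (2 B)
      then have "1 \<in> B" using adm by blast
      moreover have "B - {1} \<subseteq> {c\<in>{2..N}. c < m + Suc v}"
      proof
        fix c assume c: "c \<in> B - {1}"
        then have "1 \<le> c" "c \<le> N" "c < m + Suc v" using 2 by (auto simp: admissible_growths_def)
        then show "c \<in> {c\<in>{2..N}. c < m + Suc v}" using c by auto
      qed
      ultimately show ?case using 2 by (simp add: insert_absorb)
    next
      case (3 B)
      then show ?case by fastforce
    next
      case (4 B)
      then show ?case by blast
    next
      case (5 B)
      then have "1 \<in> B" using adm by blast
      then have B: "B = insert 1 (B - {1})" by blast
      have "B \<subseteq> {1..N}" using 5 by (auto simp: admissible_growths_def)
      then have "finite B" using finite_subset by blast
      \<comment> \<open>Column 1 was open before this step, so its new box is no maximum.\<close>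
      have "step_weight m (Suc v) 1 = 1" using True by (simp add: step_weight_def)
      then have "(\<Prod>c\<in>B. step_weight m (Suc v) c) = (\<Prod>c\<in>B - {1}. step_weight m (Suc v) c)"
        using \<open>finite B\<close> \<open>1 \<in> B\<close> by (simp add: prod.remove)
      then show ?case using coeff_insert[of _ "B - {1}"] B by simp
    qed
    also have "\<dots> = mfps_coeff {2..N} (step_factor m {2..N} (Suc v) * evolved m n {2..N} (Suc v)) (config_expo k h)"
    proof (rule mfps_coeff_step_restrict[OF h, symmetric])
      fix B assume B: "B \<subseteq> {c\<in>{2..N}. c < m + Suc v}" and nB: "B \<notin> ?T"
      have B1: "insert 1 B \<subseteq> {c\<in>{1..N}. c < m + Suc v}" using B True by fastforce
      have g1: "grow h (insert 1 B) 1 = k" using True by (simp add: grow_def)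
      have "insert 1 B \<notin> ?adm" using B nB by blast
      then have "\<not> config m N (Suc v) (grow h (insert 1 B))"
        using B1 g1 v by (simp add: admissible_growths_def minima_constraint_def)
      then obtain c where c: "1 \<le> c" "c < N" "grow h (insert 1 B) c < grow h (insert 1 B) (Suc c)"
        unfolding config_grow_iff[OF h B1] by (auto simp: not_le)
      \<comment> \<open>Column 1 itself grows, so column 2 cannot overtake it.\<close>
      have "c \<noteq> 1"
      proof
        assume "c = 1"
        then have "h 2 \<le> h 1" using h c(2) by (simp add: config_def numeral_2_eq_2)
        then show False using c(3) \<open>c = 1\<close> by (cases "2 \<in> B") (simp_all add: grow_def numeral_2_eq_2)
      qed
      then have "2 \<le> c" "grow h B c < grow h B (Suc c)" using c by (auto simp: grow_def)
      then show "(\<exists>c. 2 \<le> c \<and> c < N \<and> grow h B c < grow h B (Suc c)) \<or>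
          (\<exists>i\<in>{2..N}. config_expo k (grow h B) i < 0)"
        using c by blast
    qed (auto intro!: mfps_swap_evolved)
    also have "\<dots> = mfps_coeff {1..N} (top_series m n N v) (config_expo k h)"
      using True unfolding mfps_coeff_top_series[OF h C less_imp_neq[OF v(2)]] evolved_step[OF v(2)]
      by simp
    finally show ?thesis .
  qed
qed

text \<open>The bound makes the exponent of the first variable nonnegative, and the exponents
  increase strictly. It is applied with l = 1 if column 1 stays below k, and with l = 2 if it has
  reached k.\<close>

lemma mfps_coeff_alternant_series_config:
  assumes h: "config m N v h" and l: "1 \<le> l" and le: "h l + 2 \<le> l + k"
  shows "mfps_coeff {l..N} (alternant_series {l..N}) (config_expo k h) = 1"
proof (rule mfps_coeff_alternant_series)
  fix i assume i: "i \<in> {l..N}"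
  then have "h i \<le> h l" using config_antimono[OF h l] by simp
  then show "0 \<le> config_expo k h i" using le i by (simp add: config_expo_def)
next
  fix i j assume "i \<in> {l..N}" "j \<in> {l..N}" "i < j"
  then show "config_expo k h i < config_expo k h j"
    using l by (intro config_expo_strict_mono[OF h]) auto
qed simp

lemma sum_trajectories_eq_coefficient:
  assumes k: "1 \<le> k" and q: "k + q \<le> n + 1" and excl: "k \<noteq> 1 \<or> m + q \<noteq> 1"
  shows "(\<Sum>h\<in>trajectories m N (minima_constraint k q) n. monom 1 (card (trajectory_maxima m n h))) =
    mfps_coeff {1..N} (series_at m n N (k + q - 1) 0) (config_expo k (\<lambda>_. 0))"
proof -
  \<comment> \<open>From time k + q on column 1 is fixed at height k, and the coefficient is taken
    in the variables from 2 on.\<close>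
  define \<phi> where "\<phi> = (\<lambda>v h. if v < k + q
    then mfps_coeff {1..N} (series_at m n N (k + q - 1) v) (config_expo k h)
    else mfps_coeff {2..N} (evolved m n {2..N} v) (config_expo k h))"
  have "(\<Sum>h\<in>trajectories m N (minima_constraint k q) n. monom 1 (card (trajectory_maxima m n h))) =
      \<phi> 0 (\<lambda>_. 0)"
  proof (rule sum_trajectories_transfer[where \<phi> = \<phi>])
    fix v h assume v: "v < n" and h: "config m N v h" and C: "minima_constraint k q v h"
    consider "Suc v < k + q" | "Suc v = k + q" | "k + q \<le> v" by linarith
    then show "(\<Sum>B\<in>admissible_growths m N (minima_constraint k q) v h.
        (\<Prod>c\<in>B. step_weight m (Suc v) c) * \<phi> (Suc v) (grow h B)) = \<phi> v h"
    proof cases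
      case 1
      then show ?thesis using transfer_before[OF h k 1] by (simp add: \<phi>_def)
    next
      case 2
      then have "h 1 < k" using C by (simp add: minima_constraint_def)
      moreover have "series_at m n N (k + q - 1) v = top_series m n N v"
        using 2 by (simp add: series_at_def flip: 2)
      ultimately show ?thesis using transfer_at[OF h _ 2 v excl] 2 by (simp add: \<phi>_def)
    next
      case 3
      then have "h 1 = k" using C by (simp add: minima_constraint_def)
      then show ?thesis using transfer_after[OF h _ 3 v] 3 by (simp add: \<phi>_def)
    qed
  next
    fix h assume h: "config m N n h" and C: "minima_constraint k q n h"
    show "\<phi> n h = 1"
    proof (cases "n < k + q")
      case True
      then have "k + q - 1 = n" using q by simp
      then have "series_at m n N (k + q - 1) n = alternant_series {1..N}"
        by (simp add: series_at_def top_series_def)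
      moreover have "h 1 < k" using C True by (simp add: minima_constraint_def)
      ultimately show ?thesis
        using True mfps_coeff_alternant_series_config[OF h, of 1 k] by (simp add: \<phi>_def)
    next
      case False
      then have "h 1 = k" using C by (simp add: minima_constraint_def)
      moreover have "h 2 \<le> h 1"
        using h by (cases "2 \<le> N") (auto simp: config_def numeral_2_eq_2)
      ultimately show ?thesis
        using False mfps_coeff_alternant_series_config[OF h, of 2 k] by (simp add: \<phi>_def evolved_last)
    qed
  qed (use k in \<open>simp add: minima_constraint_def\<close>)
  also have "\<dots> = mfps_coeff {1..N} (series_at m n N (k + q - 1) 0) (config_expo k (\<lambda>_. 0))"
    using k by (simp add: \<phi>_def)
  finally show ?thesis .
qed

section \<open>The constant term as a coefficient\<close>

lemma mfps_X_power: "mfps_X i ^ e = mfps_monom (Poly_Mapping.single i e)"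
proof (induction e)
  case (Suc e)
  have "Poly_Mapping.single i 1 + Poly_Mapping.single i e = Poly_Mapping.single i (Suc e)"
    by (simp flip: single_add)
  with Suc show ?case by (simp add: mfps_X_def mfps_monom_mult)
qed (simp add: mfps_monom_0)

lemma mfps_monom_expo:
  "finite A \<Longrightarrow> (mfps_monom (expo A a) :: 'a::comm_ring_1 mfps) = (\<Prod>i\<in>A. mfps_X i ^ nat (a i))"
proof (induction A rule: finite_induct)
  case empty
  have "expo {} a = 0" by (rule poly_mapping_eqI) (simp add: lookup_expo)
  then show ?case by (simp add: mfps_monom_0)
next
  case (insert i A)
  have "Poly_Mapping.single i (nat (a i)) + expo A a = expo (insert i A) a"
    using insert by (intro poly_mapping_eqI) (auto simp: lookup_add lookup_expo lookup_single when_def)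
  then have "(mfps_monom (expo (insert i A) a) :: 'a mfps) = mfps_X i ^ nat (a i) * mfps_monom (expo A a)"
    by (simp add: mfps_X_power mfps_monom_mult)
  with insert show ?case by simp
qed

lemma prod_step_factor:
  assumes "finite A" "finite U"
  shows "(\<Prod>u\<in>U. step_factor m A u) =
    (\<Prod>c\<in>A. \<Prod>u\<in>{u\<in>U. c < m + u}. 1 + mfps_const (step_weight m u c) * mfps_X c)"
  unfolding step_factor_def by (rule prod.swap_restrict[OF assms(2,1)])

text \<open>A column open at time w has the plain factor 1 + x_i in each later step, never the one
  with P.\<close>

lemma step_factor_remove:
  assumes "finite A" "i \<in> A" "i < m + w" "w < u"
  shows "step_factor m A u = (1 + mfps_X i) * step_factor m (A - {i}) u"
proof -
  have "{c\<in>A. c < m + u} - {i} = {c\<in>A - {i}. c < m + u}" by auto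
  moreover have "step_weight m u i = 1" using assms by (simp add: step_weight_def)
  moreover have "i \<in> {c\<in>A. c < m + u}" using assms by simp
  ultimately show ?thesis
    unfolding step_factor_def using assms(1)
    by (subst prod.remove[of _ i]) (simp_all add: mfps_const_1)
qed

lemma mfps_fract_prod_step_factor:
  assumes "1 \<le> n"
  shows "mfps_fract (\<Prod>u\<in>{0<..n}. step_factor m {1..m + n - 1} u) =
    (\<Prod>i = 1..m + n - 1. (1 + x_var i) ^ n) *
    (\<Prod>i = max m 1..m + n - 1. (1 + x_var i) powi (int m - int i - 1) * (P_var * x_var i + 1))"
proof -
  let ?N = "m + n - 1"
  let ?L = "\<lambda>i u. 1 + mfps_fract (mfps_const (step_weight m u i)) * x_var i"
  let ?e = "\<lambda>i. (1 + x_var i) powi (int m - int i - 1) * (P_var * x_var i + 1)"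
  have line: "(\<Prod>u\<in>{u\<in>{0<..n}. i < m + u}. ?L i u) =
      (1 + x_var i) ^ n * (if m \<le> i then ?e i else 1)" if i: "i \<in> {1..?N}" for i
  proof (cases "m \<le> i")
    case False
    then have "{u\<in>{0<..n}. i < m + u} = {0<..n}" by auto
    moreover have "(\<Prod>u\<in>{0<..n}. ?L i u) = (\<Prod>u\<in>{0<..n}. 1 + x_var i)"
      using False by (intro prod.cong refl) (simp add: step_weight_def mfps_const_1 mfps_fract_1)
    ultimately show ?thesis using False by simp
  next
    case True
    \<comment> \<open>The step at which column i opens: its factor carries P, and n - u0 plain
      factors follow.\<close>
    define u0 where "u0 = i + 1 - m"
    have u0: "1 \<le> u0" "u0 \<le> n" "i + 1 = m + u0" using True i assms by (auto simp: u0_def)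
    have "{u\<in>{0<..n}. i < m + u} = insert u0 {u0<..n}" using u0 by auto
    then have "(\<Prod>u\<in>{u\<in>{0<..n}. i < m + u}. ?L i u) = ?L i u0 * (\<Prod>u\<in>{u0<..n}. ?L i u)"
      by simp
    also have "(\<Prod>u\<in>{u0<..n}. ?L i u) = (\<Prod>u\<in>{u0<..n}. 1 + x_var i)"
      using u0 by (intro prod.cong refl) (simp add: step_weight_def mfps_const_1 mfps_fract_1)
    also have "\<dots> = (1 + x_var i) ^ (n - u0)" by simp
    also have "\<dots> = (1 + x_var i) powi (int n + (int m - int i - 1))"
    proof -
      have "int n + (int m - int i - 1) = int (n - u0)" using u0 by linarith
      then show ?thesis by simp
    qed
    also have "\<dots> = (1 + x_var i) ^ n * (1 + x_var i) powi (int m - int i - 1)"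
      by (simp add: power_int_add one_plus_x_var_neq_0)
    also have "?L i u0 = P_var * x_var i + 1" using u0 by (simp add: step_weight_def P_var_def)
    finally show ?thesis using True by (simp add: mult_ac)
  qed
  have "mfps_fract (\<Prod>u\<in>{0<..n}. step_factor m {1..?N} u) =
      (\<Prod>i = 1..?N. \<Prod>u\<in>{u\<in>{0<..n}. i < m + u}. ?L i u)"
    by (simp add: prod_step_factor mfps_fract_simps x_var_eq)
  also have "\<dots> = (\<Prod>i = 1..?N. (1 + x_var i) ^ n * (if m \<le> i then ?e i else 1))"
    by (intro prod.cong refl line)
  also have "\<dots> = (\<Prod>i = 1..?N. (1 + x_var i) ^ n) * (\<Prod>i = 1..?N. if m \<le> i then ?e i else 1)"
    by (rule prod.distrib)
  also have "(\<Prod>i = 1..?N. if m \<le> i then ?e i else 1) = (\<Prod>i\<in>{i\<in>{1..?N}. m \<le> i}. ?e i)"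
    by (rule prod.inter_filter[symmetric]) simp
  also have "{i\<in>{1..?N}. m \<le> i} = {max m 1..?N}" by auto
  finally show ?thesis .
qed

text \<open>In the summand for i the variable x_i takes no part in the steps after w, while the full
  product counts its factors there; the power k + q - n - 1 of 1 + x_i removes these n - w
  factors.\<close>

lemma mfps_fract_series_at_0:
  assumes n: "1 \<le> n" and w: "w \<le> n" "w + 1 = k + q" and N: "N = m + n - 1"
  shows "mfps_fract (series_at m n N w 0) =
    mfps_fract (\<Prod>u\<in>{0<..n}. step_factor m {1..N} u) * alternant_fract {1..N} *
    (if w < n then (\<Sum>i = 1..k + m + q - 2.
          (1 + x_var i) powi (int k + int q - int n - 1) * (1 - x_var i)
          * (\<Prod>j\<in>{1..N} - {i}. (1 - x_var i * x_var j) / (x_var j - x_var i)))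
     else 1)"
proof (cases "w < n")
  case False
  then have "w = n" using w by simp
  then show ?thesis
    by (simp add: series_at_def top_series_def mfps_fract_simps mfps_fract_alternant_series)
next
  case True
  let ?A = "{1..N}"
  let ?r = "\<lambda>i. (1 + x_var i) powi (int k + int q - int n - 1) * (1 - x_var i)
          * (\<Prod>j\<in>?A - {i}. (1 - x_var i * x_var j) / (x_var j - x_var i))"
  define F where "F = mfps_fract (\<Prod>u\<in>{w<..n}. step_factor m ?A u)"
  \<comment> \<open>The columns open at time w = k + q - 1 form the range of the sum R.\<close>
  have I: "{i\<in>?A. i < m + w} = {1..k + m + q - 2}" using w True N by auto
  have summand: "mfps_fract ((- 1) ^ (i - 1) * evolved m n (?A - {i}) w) = F * alternant_fract ?A * ?r i"
    if i: "i \<in> {i\<in>?A. i < m + w}" for i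
  proof -
    have i': "i \<in> ?A" "i < m + w" using i by auto
    let ?G = "mfps_fract (\<Prod>u\<in>{w<..n}. step_factor m (?A - {i}) u)"
    have "(\<Prod>u\<in>{w<..n}. step_factor m ?A u) =
        (\<Prod>u\<in>{w<..n}. (1 + mfps_X i) * step_factor m (?A - {i}) u)"
      using i' by (intro prod.cong refl step_factor_remove) auto
    also have "\<dots> = (1 + mfps_X i) ^ (n - w) * (\<Prod>u\<in>{w<..n}. step_factor m (?A - {i}) u)"
      by (simp add: prod.distrib)
    finally have F: "F = (1 + x_var i) ^ (n - w) * ?G"
      by (simp add: F_def mfps_fract_mult mfps_fract_power mfps_fract_add mfps_fract_1 x_var_eq)
    have "int k + int q - int n - 1 = - int (n - w)" using w by linarith
    then have "(1 + x_var i) ^ (n - w) * (1 + x_var i) powi (int k + int q - int n - 1) = 1"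
      by (simp add: power_int_minus one_plus_x_var_neq_0)
    then have G: "?G = F * (1 + x_var i) powi (int k + int q - int n - 1)"
      unfolding F by (simp add: mult_ac)
    have "{j\<in>?A. j < i} = {1..<i}" using i' by auto
    then have "(- 1) ^ (i - 1) * alternant_fract (?A - {i}) =
        (- 1) ^ card {j\<in>?A. j < i} * alternant_fract (?A - {i})" by simp
    also note alternant_fract_remove[OF finite_atLeastAtMost i'(1)]
    finally have a: "(- 1) ^ (i - 1) * alternant_fract (?A - {i}) = alternant_fract ?A *
        ((1 - x_var i) * (\<Prod>j\<in>?A - {i}. (1 - x_var i * x_var j) / (x_var j - x_var i)))" .
    have "mfps_fract ((- 1) ^ (i - 1) * evolved m n (?A - {i}) w) =
        ?G * ((- 1) ^ (i - 1) * alternant_fract (?A - {i}))"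
      by (simp add: evolved_def mfps_fract_mult mfps_fract_power mfps_fract_uminus mfps_fract_1
          mfps_fract_alternant_series mult_ac)
    also have "\<dots> = F * alternant_fract ?A * ?r i"
      unfolding a unfolding G by (simp only: ac_simps)
    finally show ?thesis .
  qed
  have split: "{0<..n} = {0<..w} \<union> {w<..n}" using w by auto
  have "mfps_fract (\<Prod>u\<in>{0<..n}. step_factor m ?A u) =
      mfps_fract (\<Prod>u\<in>{0<..w}. step_factor m ?A u) * F"
    unfolding split F_def mfps_fract_mult[symmetric]
    by (subst prod.union_disjoint) auto
  moreover have "mfps_fract (top_series m n N w) = F * alternant_fract ?A * (\<Sum>i\<in>{i\<in>?A. i < m + w}. ?r i)"
    using True unfolding top_series_def
    by (simp only: less_imp_neq if_False mfps_fract_sum summand sum_distrib_left cong: sum.cong)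
  ultimately show ?thesis
    using True unfolding series_at_def mfps_fract_mult I by simp
qed

lemma constant_term_eq_coefficient:
  assumes k: "1 \<le> k" "k \<le> n" and q: "q \<le> n - k + 1"
  shows "has_constant_term
    (P_var ^ (if m = 0 then 1 else 0)
     * (\<Prod>i = 1..m + n - 1.
          (1 + x_var i) ^ n * x_var i powi (- int i - int k + 2) * (1 - x_var i) powi (- 1))
     * (\<Prod>i = max m 1..m + n - 1.
          (1 + x_var i) powi (int m - int i - 1) * (P_var * x_var i + 1))
     * (\<Prod>(i, j)\<in>{(i, j). 1 \<le> i \<and> i < j \<and> j \<le> m + n - 1}.
          (x_var j - x_var i) / (1 - x_var i * x_var j))
     * (if q \<le> n - k
        then (\<Sum>i = 1..k + m + q - 2.
          (1 + x_var i) powi (int k + int q - int n - 1) * (1 - x_var i)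
          * (\<Prod>j\<in>{1..m + n - 1} - {i}. (1 - x_var i * x_var j) / (x_var j - x_var i)))
        else 1))
    (monom 1 (if m = 0 then 1 else 0) *
      mfps_coeff {1..m + n - 1} (series_at m n (m + n - 1) (k + q - 1) 0) (config_expo k (\<lambda>_. 0)))"
proof -
  let ?N = "m + n - 1"
  let ?a = "config_expo k (\<lambda>_. 0)"
  let ?e = "if m = 0 then 1 else 0 :: nat"
  let ?R = "\<Sum>i = 1..k + m + q - 2.
          (1 + x_var i) powi (int k + int q - int n - 1) * (1 - x_var i)
          * (\<Prod>j\<in>{1..?N} - {i}. (1 - x_var i * x_var j) / (x_var j - x_var i))"
  let ?g = "mfps_const [:0, 1:] ^ ?e * series_at m n ?N (k + q - 1) 0"
  define U where "U = (\<Prod>i = 1..?N. (1 + x_var i) ^ n)"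
  define V where "V = (\<Prod>i = max m 1..?N. (1 + x_var i) powi (int m - int i - 1) * (P_var * x_var i + 1))"
  define W where "W = (\<Prod>(i, j)\<in>ordered_pairs {1..?N}. (x_var j - x_var i) / (1 - x_var i * x_var j))"
  define Z where "Z = (\<Prod>i = 1..?N. inverse (1 - x_var i))"
  define M where "M = mfps_fract (mfps_monom (expo {1..?N} ?a) :: int poly mfps)"
  define R where "R = (if q \<le> n - k then ?R else 1)"
  have pairs: "{(i, j). 1 \<le> i \<and> i < j \<and> j \<le> ?N} = ordered_pairs {1..?N}"
    by (auto simp: ordered_pairs_def)
  have M: "M = (\<Prod>i = 1..?N. x_var i ^ nat (?a i))"
    unfolding M_def by (simp add: mfps_monom_expo mfps_fract_simps x_var_eq)
  have "(\<Prod>i = 1..?N. (1 + x_var i) ^ n * x_var i powi (- int i - int k + 2) * (1 - x_var i) powi (- 1)) =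
      (\<Prod>i = 1..?N. (1 + x_var i) ^ n / x_var i ^ nat (?a i) * inverse (1 - x_var i))"
  proof (intro prod.cong refl)
    fix i assume "i \<in> {1..?N}"
    then have "- int i - int k + 2 = - int (nat (?a i))" using k by (simp add: config_expo_def)
    then show "(1 + x_var i) ^ n * x_var i powi (- int i - int k + 2) * (1 - x_var i) powi (- 1) =
        (1 + x_var i) ^ n / x_var i ^ nat (?a i) * inverse (1 - x_var i)"
      by (simp only: power_int_minus power_int_of_nat power_int_1_right divide_inverse)
  qed
  also have "\<dots> = U / M * Z" by (simp add: prod.distrib prod_dividef U_def Z_def M)
  finally have first: "(\<Prod>i = 1..?N. (1 + x_var i) ^ n * x_var i powi (- int i - int k + 2) *
      (1 - x_var i) powi (- 1)) = U / M * Z" .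
  have "k + q - 1 < n \<longleftrightarrow> q \<le> n - k" using k q by linarith
  then have "mfps_fract (series_at m n ?N (k + q - 1) 0) = U * V * (Z * W) * R"
    using mfps_fract_series_at_0[of n "k + q - 1" k q ?N m] k q
      mfps_fract_prod_step_factor[of n m]
    by (simp add: U_def V_def Z_def W_def R_def alternant_fract_def)
  then have "mfps_fract ?g = P_var ^ ?e * (U * V * (Z * W) * R)"
    by (simp add: mfps_fract_mult mfps_fract_power P_var_def)
  then have "P_var ^ ?e * (U / M * Z) * V * W * R = mfps_fract ?g / M"
    by simp
  moreover have "mfps_nth ?g (expo {1..?N} ?a) =
      monom 1 ?e * mfps_coeff {1..?N} (series_at m n ?N (k + q - 1) 0) ?a"
  proof -
    have "\<forall>i\<in>{1..?N}. 0 \<le> ?a i" using k by (auto simp: config_expo_def)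
    then have "mfps_coeff {1..?N} f ?a = mfps_nth f (expo {1..?N} ?a)" for f :: "int poly mfps"
      unfolding mfps_coeff_def by (rule if_P)
    then show ?thesis
      by (simp add: mfps_const_mult_nth monom_Suc one_pCons monom_0)
  qed
  ultimately show ?thesis
    unfolding has_constant_term_def pairs first V_def[symmetric] W_def[symmetric] R_def[symmetric] M_def
    by blast
qed

section \<open>Magog trapezoids and column heights\<close>

text \<open>
  The rows of the triangle are read as partitions; \<open>heights\<close> are their conjugates, and
  \<open>entries\<close> conjugates back. Both are governed by the equivalence of \<open>c < M i j\<close> with
  \<open>i < h i c + j\<close>.
\<close>

definition heights :: "nat \<Rightarrow> nat \<Rightarrow> nat \<Rightarrow> (nat \<Rightarrow> nat \<Rightarrow> nat) \<Rightarrow> nat \<Rightarrow> nat \<Rightarrow> nat" where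
  "heights n k N M u c = (if c \<in> {1..N} then card {j. (u, j) \<in> magog_positions n k \<and> c < M u j} else 0)"

definition entries :: "nat \<Rightarrow> nat \<Rightarrow> nat \<Rightarrow> (nat \<Rightarrow> nat \<Rightarrow> nat) \<Rightarrow> nat \<Rightarrow> nat \<Rightarrow> nat" where
  "entries n k N h u j = (if (u, j) \<in> magog_positions n k then Suc (card {c\<in>{1..N}. u < h u c + j}) else 0)"

lemma finite_magog_row [simp]: "finite {j. (u, j) \<in> magog_positions n k \<and> Q j}"
  by (rule finite_subset[of _ "{..n}"]) (auto simp: magog_positions_def)

text \<open>Neighbours in a row are compared through the entry of the row above that lies between
  them.\<close>

lemma magog_row_mono:
  assumes M: "M \<in> magog_trapezoids m n k" and j: "(u, j) \<in> magog_positions n k"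
    and l: "j \<le> l" "l \<le> u"
  shows "M u j \<le> M u l"
  using l
proof (induction l rule: dec_induct)
  case (step l)
  have p: "(u - 1, l) \<in> magog_positions n k" "(u - 1 + 1, l + 1) \<in> magog_positions n k"
      "(u - 1 + 1, l) \<in> magog_positions n k"
    using step j by (auto simp: magog_positions_def)
  then have "M (u - 1 + 1) l \<le> M (u - 1) l" "M (u - 1) l \<le> M (u - 1 + 1) (l + 1)"
    using M unfolding magog_trapezoids_def by blast+
  with step show ?case by simp
qed simp

lemma magog_bounds:
  assumes "M \<in> magog_trapezoids m n k" "(u, j) \<in> magog_positions n k"
  shows "1 \<le> M u j" "M u j \<le> m + j"
  using assms unfolding magog_trapezoids_def by blast+

text \<open>Rows increase weakly, so the entries above c fill the last places of row u, as many as
  the height says.\<close>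

lemma less_entry_iff_heights:
  assumes M: "M \<in> magog_trapezoids m n k" and j: "(u, j) \<in> magog_positions n k" and c: "1 \<le> c"
  shows "c < M u j \<longleftrightarrow> u < heights n k (m + n - 1) M u c + j"
proof (cases "c \<le> m + n - 1")
  case False
  have "M u j \<le> m + n" using magog_bounds(2)[OF M j] j by (auto simp: magog_positions_def)
  then show ?thesis using False j by (auto simp: heights_def magog_positions_def)
next
  case True
  let ?D = "{j. (u, j) \<in> magog_positions n k \<and> c < M u j}"
  have h: "heights n k (m + n - 1) M u c = card ?D" using True c by (simp add: heights_def)
  show ?thesis
  proof (cases "c < M u j")
    case lt: True
    have "{j..u} \<subseteq> ?D"
      using j lt magog_row_mono[OF M j] by (fastforce simp: magog_positions_def)
    then have "card {j..u} \<le> card ?D" by (intro card_mono) simp_all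
    moreover have "j \<le> u" using j by (simp add: magog_positions_def)
    ultimately show ?thesis using lt unfolding h by simp
  next
    case False
    have "?D \<subseteq> {j<..u}"
    proof
      fix l assume l: "l \<in> ?D"
      then have "l \<le> u" by (simp add: magog_positions_def)
      moreover have "\<not> l \<le> j"
      proof
        assume "l \<le> j"
        then have "M u l \<le> M u j" using l j by (intro magog_row_mono[OF M]) (auto simp: magog_positions_def)
        then show False using l False by simp
      qed
      ultimately show "l \<in> {j<..u}" by simp
    qed
    then have "card ?D \<le> card {j<..u}" by (intro card_mono) simp_all
    moreover have "j \<le> u" using j by (simp add: magog_positions_def)
    ultimately show ?thesis using False unfolding h by simp
  qed
qed

lemma trajectoriesD:
  assumes "h \<in> trajectories m N C n"
  shows "n < u \<Longrightarrow> h u c = 0" "h 0 c = 0" "u < n \<Longrightarrow> h u c \<le> h (Suc u) c"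
    "u < n \<Longrightarrow> h (Suc u) c \<le> Suc (h u c)" "u \<le> n \<Longrightarrow> config m N u (h u)" "u \<le> n \<Longrightarrow> C u (h u)"
proof -
  have h: "\<And>u c. n < u \<Longrightarrow> h u c = 0" "\<And>c. h 0 c = 0"
    "\<And>u c. u < n \<Longrightarrow> h (Suc u) c = h u c \<or> h (Suc u) c = Suc (h u c)"
    "\<And>u. u \<le> n \<Longrightarrow> config m N u (h u)" "\<And>u. u \<le> n \<Longrightarrow> C u (h u)"
    using assms unfolding trajectories_def by simp_all
  show "n < u \<Longrightarrow> h u c = 0" "h 0 c = 0" "u \<le> n \<Longrightarrow> config m N u (h u)" "u \<le> n \<Longrightarrow> C u (h u)"
    using h by simp_all
  show "u < n \<Longrightarrow> h u c \<le> h (Suc u) c" "u < n \<Longrightarrow> h (Suc u) c \<le> Suc (h u c)"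
    using h(3)[of u c] by linarith+
qed

lemma trajectories_increment:
  assumes h: "h \<in> trajectories m N C n"
  shows "v + d \<le> n \<Longrightarrow> h (v + d) c \<le> h v c + d"
proof (induction d)
  case (Suc d)
  then show ?case using trajectoriesD(4)[OF h, of "v + d" c] by simp
qed simp

text \<open>The heights decrease in c, so the columns counted by \<open>entries\<close> form an
  initial segment; the \<open>Suc\<close> there shifts parts of a partition to entries starting at
  1.\<close>

lemma less_entries_iff:
  assumes h: "config m N u (h u)" and j: "(u, j) \<in> magog_positions n k" and c: "1 \<le> c"
  shows "c < entries n k N h u j \<longleftrightarrow> u < h u c + j"
proof -
  let ?D = "{c\<in>{1..N}. u < h u c + j}"
  have e: "entries n k N h u j = Suc (card ?D)" using j by (simp add: entries_def)
  show ?thesis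
  proof (cases "u < h u c + j")
    case True
    have "j \<le> u" using j by (simp add: magog_positions_def)
    then have "h u c \<noteq> 0" using True by auto
    then have N: "c \<in> {1..N}" using config_eq_0[OF h] by metis
    have "{1..c} \<subseteq> ?D"
    proof
      fix d assume d: "d \<in> {1..c}"
      then have "h u c \<le> h u d" using config_antimono[OF h, of d c] N by simp
      then show "d \<in> ?D" using True N d by simp
    qed
    then have "card {1..c} \<le> card ?D" by (intro card_mono) simp_all
    then show ?thesis using True unfolding e by simp
  next
    case False
    have "?D \<subseteq> {1..<c}"
    proof
      fix d assume d: "d \<in> ?D"
      have "\<not> c \<le> d"
      proof
        assume "c \<le> d"
        then have "h u d \<le> h u c" using config_antimono[OF h c] d by simp
        then show False using d False by simp
      qed
      then show "d \<in> {1..<c}" using d by simp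
    qed
    then have "card ?D \<le> card {1..<c}" by (intro card_mono) simp_all
    then show ?thesis using False c unfolding e by simp
  qed
qed

text \<open>By monotonicity the times with value below k form an initial segment of
  \<open>{k..n}\<close>, so their number tells when k is reached.\<close>

lemma card_initial_segment_iff:
  fixes g :: "nat \<Rightarrow> nat"
  assumes mono: "\<And>u. u < n \<Longrightarrow> g u \<le> g (Suc u)" and u: "k \<le> u" "u \<le> n"
  shows "g u < k \<longleftrightarrow> u < k + card {u. k \<le> u \<and> u \<le> n \<and> g u < k}"
proof -
  let ?D = "{u. k \<le> u \<and> u \<le> n \<and> g u < k}"
  have g: "g v \<le> g w" if "v \<le> w" "w \<le> n" for v w
    using that by (induction w rule: dec_induct) (auto intro: order.trans[OF _ mono])
  have fin: "finite ?D" by (rule finite_subset[of _ "{..n}"]) auto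
  show ?thesis
  proof (cases "g u < k")
    case True
    have "{k..u} \<subseteq> ?D"
    proof
      fix v assume v: "v \<in> {k..u}"
      then have "g v \<le> g u" using g u(2) by simp
      then show "v \<in> ?D" using True u v by simp
    qed
    then have "card {k..u} \<le> card ?D" using fin by (rule card_mono[rotated])
    then show ?thesis using True u by simp
  next
    case False
    have "?D \<subseteq> {k..<u}"
    proof
      fix v assume v: "v \<in> ?D"
      then have "\<not> u \<le> v" using g[of u v] False by auto
      then show "v \<in> {k..<u}" using v by simp
    qed
    then have "card ?D \<le> card {k..<u}" by (intro card_mono) simp_all
    then show ?thesis using False u by simp
  qed
qed

text \<open>In row u the leftmost diagonal has j = u + 1 - k, where the condition
  \<open>u < h u 1 + j\<close> becomes \<open>k \<le> h u 1\<close>. So its entry is 1 exactly while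
  the first column is below k.\<close>

lemma card_magog_minima:
  assumes k: "1 \<le> k" and pos: "\<And>u j. (u, j) \<in> magog_positions n k \<Longrightarrow> 1 \<le> M u j"
    and rel: "\<And>u j. (u, j) \<in> magog_positions n k \<Longrightarrow> 1 < M u j \<longleftrightarrow> u < h u 1 + j"
  shows "card (magog_minima n k M) = card {u. k \<le> u \<and> u \<le> n \<and> h u 1 < k}"
proof -
  have eq: "magog_minima n k M = (\<lambda>u. (u, u + 1 - k)) ` {u. k \<le> u \<and> u \<le> n \<and> h u 1 < k}"
  proof (intro set_eqI iffI)
    fix p assume "p \<in> magog_minima n k M"
    then obtain u j where p: "p = (u, j)" "(u, j) \<in> magog_positions n k" "u + 1 = j + k" "M u j = 1"
      by (auto simp: magog_minima_def)
    then have "\<not> u < h u 1 + j" using rel[of u j] by simp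
    with p have "u \<in> {u. k \<le> u \<and> u \<le> n \<and> h u 1 < k}" "j = u + 1 - k"
      by (auto simp: magog_positions_def)
    then show "p \<in> (\<lambda>u. (u, u + 1 - k)) ` {u. k \<le> u \<and> u \<le> n \<and> h u 1 < k}" using p(1) by blast
  next
    fix p assume "p \<in> (\<lambda>u. (u, u + 1 - k)) ` {u. k \<le> u \<and> u \<le> n \<and> h u 1 < k}"
    then obtain u where u: "p = (u, u + 1 - k)" "k \<le> u" "u \<le> n" "h u 1 < k" by blast
    define j where "j = u + 1 - k"
    have j: "u + 1 = j + k" using u(2) by (simp add: j_def)
    then have P: "(u, j) \<in> magog_positions n k" using k u by (simp add: magog_positions_def)
    have "\<not> 1 < M u j" using rel[OF P] u(4) j by simp
    then have "M u j = 1" using pos[OF P] by simp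
    then show "p \<in> magog_minima n k M" using P j by (simp add: magog_minima_def u(1) flip: j_def)
  qed
  show ?thesis unfolding eq by (rule card_image) (auto simp: inj_on_def)
qed

lemma heights_trajectories:
  assumes k: "1 \<le> k" and M: "M \<in> magog_trapezoids m n k"
  shows "heights n k (m + n - 1) M \<in>
    trajectories m (m + n - 1) (minima_constraint k (card (magog_minima n k M))) n"
proof -
  let ?N = "m + n - 1" and ?q = "card (magog_minima n k M)"
  let ?h = "heights n k (m + n - 1) M"
  let ?D = "\<lambda>u c. {j. (u, j) \<in> magog_positions n k \<and> c < M u j}"
  \<comment> \<open>The SE neighbour of an entry above c is again above c, so the places of row u
    embed into row u + 1 by a shift.\<close>
  have up: "?h u c \<le> ?h (Suc u) c" if "u < n" for u c
  proof -
    have "Suc ` ?D u c \<subseteq> ?D (Suc u) c"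
    proof
      fix l assume "l \<in> Suc ` ?D u c"
      then obtain j where j: "l = Suc j" "(u, j) \<in> magog_positions n k" "c < M u j" by blast
      then have p: "(u + 1, j + 1) \<in> magog_positions n k" using that by (simp add: magog_positions_def)
      then have "M u j \<le> M (u + 1) (j + 1)" using M j(2) unfolding magog_trapezoids_def by blast
      then show "l \<in> ?D (Suc u) c" using j p by simp
    qed
    then have "card (Suc ` ?D u c) \<le> card (?D (Suc u) c)" by (intro card_mono) simp_all
    then show ?thesis by (simp add: heights_def card_image)
  qed
  \<comment> \<open>Entries do not increase down a column of the array, so the only new place in row
    u + 1 is the diagonal one.\<close>
  have down: "?h (Suc u) c \<le> Suc (?h u c)" if "u < n" for u c
  proof -
    have "?D (Suc u) c \<subseteq> insert (Suc u) (?D u c)"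
    proof
      fix j assume j: "j \<in> ?D (Suc u) c"
      show "j \<in> insert (Suc u) (?D u c)"
      proof (cases "j = Suc u")
        case False
        then have p: "(u, j) \<in> magog_positions n k" using j by (auto simp: magog_positions_def)
        then have "M (u + 1) j \<le> M u j" using M j unfolding magog_trapezoids_def by auto
        then show ?thesis using j p by simp
      qed simp
    qed
    then have "card (?D (Suc u) c) \<le> card (insert (Suc u) (?D u c))" by (intro card_mono) simp_all
    also have "\<dots> \<le> Suc (card (?D u c))" by (simp add: card_insert_if)
    finally show ?thesis by (simp add: heights_def)
  qed
  have config: "config m ?N u (?h u)" for u
    unfolding config_def
  proof (intro conjI allI impI)
    fix c assume "c \<notin> {1..?N} \<or> m + u \<le> c"
    then show "?h u c = 0"
    proof
      assume c: "m + u \<le> c"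
      have "?D u c = {}"
      proof (intro equals0I)
        fix j assume "j \<in> ?D u c"
        then have "(u, j) \<in> magog_positions n k" "c < M u j" by auto
        then show False using magog_bounds(2)[OF M, of u j] c by (auto simp: magog_positions_def)
      qed
      then show ?thesis by (simp only: heights_def card.empty if_cancel)
    qed (auto simp: heights_def)
  next
    fix c assume "1 \<le> c \<and> c < ?N"
    moreover have "card (?D u (Suc c)) \<le> card (?D u c)" by (intro card_mono) auto
    ultimately show "?h u (Suc c) \<le> ?h u c" by (simp add: heights_def)
  qed
  \<comment> \<open>Row u has at most k and at most u places; the second bound makes the constraint
    automatic for u < k.\<close>
  have small: "?h u 1 \<le> k" "?h u 1 \<le> u" for u
  proof -
    have "card (?D u 1) \<le> card {u + 1 - k..u}"
      by (intro card_mono) (auto simp: magog_positions_def)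
    moreover have "card (?D u 1) \<le> card {1..u}"
      by (intro card_mono) (auto simp: magog_positions_def)
    ultimately show "?h u 1 \<le> k" "?h u 1 \<le> u" by (auto simp: heights_def)
  qed
  have q: "?q = card {u. k \<le> u \<and> u \<le> n \<and> ?h u 1 < k}"
    using magog_bounds(1)[OF M] less_entry_iff_heights[OF M, of _ _ 1]
    by (intro card_magog_minima[OF k]) auto
  have "minima_constraint k ?q u (?h u)" if "u \<le> n" for u
  proof (cases "k \<le> u")
    case True
    then show ?thesis
      using card_initial_segment_iff[of n "\<lambda>u. ?h u 1" k u] up that small(1)[of u]
      unfolding minima_constraint_def q by auto
  next
    case False
    then show ?thesis using small(2)[of u] by (simp add: minima_constraint_def)
  qed
  moreover have "?h u c = 0" if "n < u \<or> u = 0" for u c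
  proof -
    have "(u, j) \<notin> magog_positions n k" for j using that by (auto simp: magog_positions_def)
    then show ?thesis by (simp add: heights_def)
  qed
  moreover have "?h (Suc u) c = ?h u c \<or> ?h (Suc u) c = Suc (?h u c)" if "u < n" for u c
    using up[OF that, of c] down[OF that, of c] by linarith
  ultimately show ?thesis using config by (simp add: trajectories_def)
qed

lemma entries_magog:
  assumes k: "1 \<le> k" and q: "k + q \<le> n + 1"
    and h: "h \<in> trajectories m (m + n - 1) (minima_constraint k q) n"
  shows "entries n k (m + n - 1) h \<in> magog_trapezoids m n k"
    and "card (magog_minima n k (entries n k (m + n - 1) h)) = q"
proof -
  let ?M = "entries n k (m + n - 1) h"
  have pos: "1 \<le> ?M u j" if "(u, j) \<in> magog_positions n k" for u j
    using that by (simp add: entries_def)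
  have iff: "c < ?M u j \<longleftrightarrow> u < h u c + j" if "(u, j) \<in> magog_positions n k" "1 \<le> c" for u j c
    using that by (intro less_entries_iff[where m = m] trajectoriesD(5)[OF h]) (auto simp: magog_positions_def)
  have le: "?M u j \<le> ?M v l"
    if "(u, j) \<in> magog_positions n k" "(v, l) \<in> magog_positions n k"
      "\<And>c. u < h u c + j \<Longrightarrow> v < h v c + l" for u j v l
    using iff[OF that(1) pos[OF that(2)]] iff[OF that(2) pos[OF that(2)]] that(3) by (meson less_irrefl not_le)
  \<comment> \<open>Column m + j is closed up to time j and then gains at most one box per step, so
    at time u it has at most u - j boxes.\<close>
  have upper: "?M u j \<le> m + j" if p: "(u, j) \<in> magog_positions n k" for u j
  proof -
    have j: "1 \<le> j" "j \<le> u" "u \<le> n" using p by (auto simp: magog_positions_def)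
    then have "h j (m + j) = 0" using trajectoriesD(5)[OF h, of j] by (simp add: config_def)
    then have "h u (m + j) \<le> u - j"
      using trajectories_increment[OF h, of j "u - j" "m + j"] j by simp
    then have "\<not> u < h u (m + j) + j" using j by linarith
    then have "\<not> m + j < ?M u j" using iff[OF p, of "m + j"] j by linarith
    then show ?thesis by simp
  qed
  have down: "?M (i + 1) j \<le> ?M i j"
    if "(i, j) \<in> magog_positions n k" "(i + 1, j) \<in> magog_positions n k" for i j
  proof (rule le[OF that(2,1)])
    fix c assume "i + 1 < h (i + 1) c + j"
    moreover have "i < n" using that(2) by (simp add: magog_positions_def)
    ultimately show "i < h i c + j" using trajectoriesD(4)[OF h, of i c] by simp
  qed
  have diag: "?M i j \<le> ?M (i + 1) (j + 1)"
    if "(i, j) \<in> magog_positions n k" "(i + 1, j + 1) \<in> magog_positions n k" for i j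
  proof (rule le[OF that])
    fix c assume "i < h i c + j"
    moreover have "i < n" using that(2) by (simp add: magog_positions_def)
    ultimately show "i + 1 < h (i + 1) c + (j + 1)" using trajectoriesD(3)[OF h, of i c] by simp
  qed
  have "?M i j = 0" if "(i, j) \<notin> magog_positions n k" for i j
    using that by (simp add: entries_def)
  then show "?M \<in> magog_trapezoids m n k"
    unfolding magog_trapezoids_def using pos upper down diag by blast
  have "card (magog_minima n k ?M) = card {u. k \<le> u \<and> u \<le> n \<and> h u 1 < k}"
    using pos iff by (intro card_magog_minima[OF k]) auto
  also have "{u. k \<le> u \<and> u \<le> n \<and> h u 1 < k} = {k..<k + q}"
  proof (intro set_eqI)
    fix u
    show "u \<in> {u. k \<le> u \<and> u \<le> n \<and> h u 1 < k} \<longleftrightarrow> u \<in> {k..<k + q}"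
    proof (cases "u \<le> n")
      case True
      then show ?thesis
        using trajectoriesD(6)[OF h True] by (cases "u < k + q") (simp_all add: minima_constraint_def)
    qed (use q in simp)
  qed
  finally show "card (magog_minima n k ?M) = q" by simp
qed

lemma heights_entries:
  assumes h: "h \<in> trajectories m (m + n - 1) (minima_constraint k q) n"
  shows "heights n k (m + n - 1) (entries n k (m + n - 1) h) = h"
proof (intro ext)
  fix u c
  let ?N = "m + n - 1"
  show "heights n k ?N (entries n k ?N h) u c = h u c"
  proof (cases "u \<le> n \<and> c \<in> {1..?N}")
    case False
    then have "h u c = 0"
      using trajectoriesD(1)[OF h] config_eq_0[OF trajectoriesD(5)[OF h]] by (metis not_le)
    moreover have "{j. (u, j) \<in> magog_positions n k \<and> Q j} = {}" if "\<not> u \<le> n" for Q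
      using that by (auto simp: magog_positions_def)
    ultimately show ?thesis using False by (auto simp: heights_def)
  next
    case True
    then have u: "u \<le> n" and c: "c \<in> {1..?N}" by auto
    note cf = trajectoriesD(5)[OF h u]
    have "h u c \<le> h u 1" using config_antimono[OF cf, of 1 c] c by simp
    also have "\<dots> \<le> k" using trajectoriesD(6)[OF h u] by (simp add: minima_constraint_def split: if_splits)
    finally have hk: "h u c \<le> k" .
    have hu: "h u c \<le> u"
      using trajectories_increment[OF h, of 0 u c] trajectoriesD(2)[OF h, of c] u by simp
    have "{j. (u, j) \<in> magog_positions n k \<and> c < entries n k ?N h u j} =
        {j. (u, j) \<in> magog_positions n k \<and> u < h u c + j}"
      using less_entries_iff[of m ?N u h _ n k c] cf c by auto
    \<comment> \<open>\<open>hk\<close> keeps the interval within the k diagonals, and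
      \<open>hu\<close> keeps it within \<open>1 \<le> j\<close>.\<close>
    also have "\<dots> = {u + 1 - h u c..u}"
      using hk hu u by (auto simp: magog_positions_def)
    finally show ?thesis using hu c by (simp add: heights_def)
  qed
qed

lemma entries_heights:
  assumes M: "M \<in> magog_trapezoids m n k"
  shows "entries n k (m + n - 1) (heights n k (m + n - 1) M) = M"
proof (intro ext)
  fix u j
  let ?N = "m + n - 1"
  show "entries n k ?N (heights n k ?N M) u j = M u j"
  proof (cases "(u, j) \<in> magog_positions n k")
    case False
    then show ?thesis using M by (simp add: entries_def magog_trapezoids_def)
  next
    case True
    have "{c\<in>{1..?N}. u < heights n k ?N M u c + j} = {c\<in>{1..?N}. c < M u j}"
      using less_entry_iff_heights[OF M True] by auto
    also have "\<dots> = {1..<M u j}"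
      using magog_bounds[OF M True] True by (auto simp: magog_positions_def)
    finally show ?thesis using True magog_bounds(1)[OF M True] by (simp add: entries_def)
  qed
qed

text \<open>\<open>M j j\<close> is maximal if it exceeds m + j - 1, that is, if that column is
  nonempty at time j. For m = 0 the entry \<open>M 1 1\<close> is forced to be 1 and always a
  maximum, but it leaves no trace in the heights; hence the summand 1.\<close>

lemma card_magog_maxima:
  assumes k: "1 \<le> k" and n: "1 \<le> n" and M: "M \<in> magog_trapezoids m n k"
  shows "card (magog_maxima m n k M) =
    (if m = 0 then 1 else 0) + card (trajectory_maxima m n (heights n k (m + n - 1) M))"
proof -
  let ?h = "heights n k (m + n - 1) M"
  let ?E = "if m = 0 then {1::nat} else {}"
  have P: "(j, j) \<in> magog_positions n k" if "1 \<le> j" "j \<le> n" for j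
    using that k by (simp add: magog_positions_def)
  have "M j j = m + j \<longleftrightarrow> j \<in> ?E \<union> trajectory_maxima m n ?h" if j: "1 \<le> j" "j \<le> n" for j
  proof (cases "m + j = 1")
    case True
    then show ?thesis using j magog_bounds[OF M P[OF j]] by auto
  next
    case False
    then have "m + j - 1 < M j j \<longleftrightarrow> 0 < ?h j (m + j - 1)"
      using less_entry_iff_heights[OF M P[OF j], of "m + j - 1"] j by simp
    then show ?thesis
      using False j magog_bounds[OF M P[OF j]] by (auto simp: trajectory_maxima_def)
  qed
  moreover have "1 \<le> j \<and> j \<le> n" if "j \<in> ?E \<union> trajectory_maxima m n ?h" for j
    using that n by (auto simp: trajectory_maxima_def split: if_splits)
  ultimately have "magog_maxima m n k M = (\<lambda>j. (j, j)) ` (?E \<union> trajectory_maxima m n ?h)"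
    using P by (force simp: magog_maxima_def magog_positions_def image_iff)
  then have "card (magog_maxima m n k M) = card (?E \<union> trajectory_maxima m n ?h)"
    by (simp add: card_image inj_on_def)
  also have "\<dots> = card ?E + card (trajectory_maxima m n ?h)"
    by (rule card_Un_disjoint) (auto simp: trajectory_maxima_def heights_def)
  finally show ?thesis by simp
qed

lemma sum_magog_eq_sum_trajectories:
  assumes k: "1 \<le> k" "k \<le> n" and q: "k + q \<le> n + 1"
  shows "(\<Sum>M\<in>{M \<in> magog_trapezoids m n k. card (magog_minima n k M) = q}.
      monom 1 (card (magog_maxima m n k M))) =
    (monom 1 (if m = 0 then 1 else 0) * (\<Sum>h\<in>trajectories m (m + n - 1) (minima_constraint k q) n.
      monom 1 (card (trajectory_maxima m n h))) :: int poly)"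
  unfolding sum_distrib_left
proof (rule sum.reindex_bij_witness[where i = "entries n k (m + n - 1)" and j = "heights n k (m + n - 1)"])
  fix M assume M: "M \<in> {M \<in> magog_trapezoids m n k. card (magog_minima n k M) = q}"
  then show "entries n k (m + n - 1) (heights n k (m + n - 1) M) = M"
    using entries_heights by blast
  show "heights n k (m + n - 1) M \<in> trajectories m (m + n - 1) (minima_constraint k q) n"
    using M heights_trajectories[OF k(1)] by blast
  have "1 \<le> n" using k by simp
  then show "monom 1 (if m = 0 then 1 else 0) * monom 1 (card (trajectory_maxima m n (heights n k (m + n - 1) M))) =
      (monom 1 (card (magog_maxima m n k M)) :: int poly)"
    using M card_magog_maxima[OF k(1)] by (simp add: mult_monom)
next
  fix h assume h: "h \<in> trajectories m (m + n - 1) (minima_constraint k q) n"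
  show "heights n k (m + n - 1) (entries n k (m + n - 1) h) = h" by (rule heights_entries[OF h])
  show "entries n k (m + n - 1) h \<in> {M \<in> magog_trapezoids m n k. card (magog_minima n k M) = q}"
    using entries_magog[OF k(1) q h] by simp
qed

theorem theorem4p4:
  fixes m n k q :: nat
  assumes "1 \<le> k" "k \<le> n"
    and "q \<le> n - k + 1"
    and "k \<noteq> 1 \<or> m + q \<noteq> 1"
  shows "has_constant_term
    (P_var ^ (if m = 0 then 1 else 0)
     * (\<Prod>i = 1..m + n - 1.
          (1 + x_var i) ^ n * x_var i powi (- int i - int k + 2) * (1 - x_var i) powi (- 1))
     * (\<Prod>i = max m 1..m + n - 1.
          (1 + x_var i) powi (int m - int i - 1) * (P_var * x_var i + 1))
     * (\<Prod>(i, j)\<in>{(i, j). 1 \<le> i \<and> i < j \<and> j \<le> m + n - 1}.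
          (x_var j - x_var i) / (1 - x_var i * x_var j))
     * (if q \<le> n - k
        then (\<Sum>i = 1..k + m + q - 2.
          (1 + x_var i) powi (int k + int q - int n - 1) * (1 - x_var i)
          * (\<Prod>j\<in>{1..m + n - 1} - {i}. (1 - x_var i * x_var j) / (x_var j - x_var i)))
        else 1))
    (\<Sum>M\<in>{M \<in> magog_trapezoids m n k. card (magog_minima n k M) = q}.
       monom 1 (card (magog_maxima m n k M)))"
proof -
  have q: "k + q \<le> n + 1" using assms(2,3) by linarith
  show ?thesis
    unfolding sum_magog_eq_sum_trajectories[OF assms(1,2) q]
      sum_trajectories_eq_coefficient[OF assms(1) q assms(4)]
    by (rule constant_term_eq_coefficient[OF assms(1-3)])
qed

end
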